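(* Consider a query stream of rate $\lambda$ with sources $s_1,s_2$ and destination $d$, where each query may be computed at any one node of the set $\mathcal{N}_C=\{n_1,\dots,n_{N_C}\}$ of computation nodes. If the system is stable under some policy in $\Pi_C$, then there exist $\lambda_m\ge 0$, $m\in\mathcal{N}_C$, such that $$\bm{\lambda}\in\Lambda_{\mathcal{G}}(\widetilde{\mathcal{C}}_3),\qquad \lambda_m\le C_m\ \ \forall m\in\mathcal{N}_C,\qquad \sum_{m\in\mathcal{N}_C}\lambda_m=\lambda ,$$ where $\widetilde{\mathcal{C}}_3$ consists of the $3N_C$ commodities $(s_1,m),(s_2,m),(m,d)$, $m\in\mathcal{N}_C$, and $\bm{\lambda}$ is the rate vector assigning rate $\lambda_m$ to each of the three commodities $(s_1,m),(s_2,m),(m,d)$.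
   Context: Network: $\mathcal{G}=(\mathcal{V},\mathcal{E})$ is a finite graph with undirected edges; the edge between $m$ and $k$ has a fixed capacity $R_{mk}=R_{km}$ (packets per slot), shared by the two directions. $s_1,s_2\in\mathcal{V}$ are the sources, $d\in\mathcal{V}$ the destination, $\mathcal{N}_C\subseteq\mathcal{V}$ the computation nodes; node $n\in\mathcal{N}_C$ can process at most $C_n$ pairs per slot. Queries: time is slotted; $A(t)$ queries arrive in slot $t$, where $A(t)$ is i.i.d. over time with values in the nonnegative integers and $\mathbb{E}[A(t)]=\lambda$. Each query generates one raw packet at $s_1$ and one at $s_2$, both carrying the same tag (distinct queries have distinct tags). Each query is assigned on arrival to one computation node $n\in\mathcal{N}_C$; its two raw packets must both be brought to $n$ and combined there into one processed packet, which must be delivered to $d$. Queues (lengths at slot $t$, for each $n\in\mathcal{N}_C$): $Q_k^{(i,n)}(t)$, $i=1,2$, counts raw packets from $s_i$ assigned to $n$ waiting at node $k$ on their way to $n$ (with $Q_n^{(i,n)}(t)=0$); $X_n^{(i)}(t)$, $i=1,2$, counts raw packets from $s_i$ that have reached their computation node $n$ and wait to be combined, and $\mathcal{X}_n^{(i)}(t)$ is their set of tags; $Q_k^{(0,n)}(t)$ counts processed packets produced at $n$ waiting at $k$ on their way to $d$ (with $Q_d^{(0,n)}(t)=0$). Policies $\Pi_C$: in every slot the policy chooses, based on the network state, the assignment of new queries to computation nodes, the numbers $U_{mk}^{(i,n)}(t)\ge 0$ of packets of class $(i,n)$, $i\in\{0,1,2\}$, $n\in\mathcal{N}_C$, transmitted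 from $m$ to $k$, and for each $n$ a set $\mathcal{Z}_n(t)$ of $Z_n(t)$ tags whose raw packets are combined at $n$, subject to: (i) $\sum_{i,n}\big(U_{mk}^{(i,n)}(t)+U_{km}^{(i,n)}(t)\big)\le R_{mk}$ for each edge; (ii) $0\le Z_n(t)\le\min[C_n,X_n^{(1)}(t),X_n^{(2)}(t)]$; (iii) $\mathcal{Z}_n(t)\subseteq \mathcal{X}_n^{(1)}(t)\cap\mathcal{X}_n^{(2)}(t)$. If more service is allocated on links than there are packets in the queue, only the existing packets are moved. Stability: all queues are strongly stable, i.e. $\limsup_{T\to\infty}\frac1T\sum_{t=1}^T\mathbb{E}[Q_k^{(i,n)}(t)]<\infty$ for all $k\in\mathcal{V}$, $i\in\{0,1,2\}$, $n\in\mathcal{N}_C$, and $\limsup_{T\to\infty}\frac1T\sum_{t=1}^T\mathbb{E}[X_n^{(i)}(t)]<\infty$ for $i\in\{1,2\}$, $n\in\mathcal{N}_C$. Flow region: for a finite set $\mathcal{C}$ of commodities (each with a source and a destination), $\Lambda_{\mathcal{G}}(\mathcal{C})$ is the set of rate vectors $(\lambda^{(c)})_{c\in\mathcal{C}}$ for which there exist flows $f_{mk}^{(c)}\ge 0$ (for each edge and each of its two directions) such that for every $c$ and node $m$, $\sum_k f_{mk}^{(c)}-\sum_k f_{km}^{(c)}$ equals $\lambda^{(c)}$ if $m$ is the source of $c$, $-\lambda^{(c)}$ if $m$ is the destination of $c$, and $0$ otherwise; $f_{mk}^{(c)}=0$ whenever $m$ is the destination of $c$; and $\sum_{c}\big(f_{mk}^{(c)}+f_{km}^{(c)}\big)\le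 R_{mk}$ for each edge. A commodity whose source equals its destination requires no flow. *)

theory Defs
  imports "HOL-Probability.Probability"
begin

text \<open>
  An undirected edge between m and k is represented by both ordered pairs (m, k) and (k, m), so that
  an ordered pair in the edge relation also denotes one of the two directions of the edge.
\<close>

record 'v query_network =
  nodes :: "'v set"
  edges :: "('v \<times> 'v) set"
  link_cap :: "'v \<Rightarrow> 'v \<Rightarrow> real"
  source1 :: 'v
  source2 :: 'v
  sink :: 'v
  comp_nodes :: "'v set"
  comp_cap :: "'v \<Rightarrow> real"

definition wf_network :: "'v query_network \<Rightarrow> bool" where
  "wf_network N \<longleftrightarrow>
     finite (nodes N) \<and>
     edges N \<subseteq> nodes N \<times> nodes N \<and> sym (edges N) \<and> irrefl (edges N) \<and>
     (\<forall>(m, k)\<in>edges N. 0 \<le> link_cap N m k \<and> link_cap N m k = link_cap N k m) \<and>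
     source1 N \<in> nodes N \<and> source2 N \<in> nodes N \<and> sink N \<in> nodes N \<and>
     comp_nodes N \<subseteq> nodes N \<and>
     (\<forall>n\<in>comp_nodes N. 0 \<le> comp_cap N n)"

definition nbrs :: "('v \<times> 'v) set \<Rightarrow> 'v \<Rightarrow> 'v set" where
  "nbrs E m = {k. (m, k) \<in> E}"

text \<open>
  Commodities are labels c in a set I, with source src c and destination dst c. Labels are used
  instead of bare (source, destination) pairs because two different commodities of the family may
  have the same end points. Only the values of the rate vector on I matter.
\<close>

definition flow_region ::
  "'v set \<Rightarrow> ('v \<times> 'v) set \<Rightarrow> ('v \<Rightarrow> 'v \<Rightarrow> real) \<Rightarrow> 'c set \<Rightarrow> ('c \<Rightarrow> 'v) \<Rightarrow> ('c \<Rightarrow> 'v) \<Rightarrow> ('c \<Rightarrow> real) set"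
where
  "flow_region V E R I src dst = {r. \<exists>f :: 'c \<Rightarrow> 'v \<Rightarrow> 'v \<Rightarrow> real.
     (\<forall>c\<in>I. \<forall>(m, k)\<in>E. 0 \<le> f c m k) \<and>
     (\<forall>c\<in>I. src c = dst c \<longrightarrow> (\<forall>(m, k)\<in>E. f c m k = 0)) \<and>
     (\<forall>c\<in>I. src c \<noteq> dst c \<longrightarrow> (\<forall>m\<in>V.
        (\<Sum>k\<in>nbrs E m. f c m k) - (\<Sum>k\<in>nbrs E m. f c k m) =
          (if m = src c then r c else if m = dst c then - r c else 0))) \<and>
     (\<forall>c\<in>I. \<forall>(m, k)\<in>E. m = dst c \<longrightarrow> f c m k = 0) \<and>
     (\<forall>(m, k)\<in>E. (\<Sum>c\<in>I. f c m k + f c k m) \<le> R m k)}"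

text \<open>
  Class (i, n): for i = 1, 2 the raw packets of source i assigned to computation node n,
  for i = 0 the processed packets produced at n.
\<close>

definition packet_classes :: "'v query_network \<Rightarrow> (nat \<times> 'v) set" where
  "packet_classes N = {0, 1, 2} \<times> comp_nodes N"

fun class_src :: "'v query_network \<Rightarrow> nat \<times> 'v \<Rightarrow> 'v" where
  "class_src N (i, n) = (if i = 0 then n else if i = 1 then source1 N else source2 N)"

fun class_dst :: "'v query_network \<Rightarrow> nat \<times> 'v \<Rightarrow> 'v" where
  "class_dst N (i, n) = (if i = 0 then sink N else n)"

text \<open>The j-th query arriving in slot t carries the tag (t, j).\<close>

type_synonym tag = "nat \<times> nat"

definition new_tags :: "(nat \<Rightarrow> 'w \<Rightarrow> nat) \<Rightarrow> nat \<Rightarrow> 'w \<Rightarrow> tag set" where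
  "new_tags A t \<omega> = {t} \<times> {..<A t \<omega>}"

text \<open>
  Queue contents are sets of tags: every query has at most one packet in each class, so the
  queue lengths are the cardinalities. \<open>queued S i n k\<close> holds the packets of class (i, n) waiting
  at node k, and \<open>waiting S i n\<close> the raw packets of source i waiting at n to be combined.
\<close>

record 'v net_state =
  queued :: "nat \<Rightarrow> 'v \<Rightarrow> 'v \<Rightarrow> tag set"
  waiting :: "nat \<Rightarrow> 'v \<Rightarrow> tag set"

text \<open>
  The decisions of one slot: \<open>assigned D n\<close> are the new queries assigned to n;
  \<open>service D i n m k\<close> is the service allocated to class (i, n) on the link from m to k, and
  \<open>moved D i n m k\<close> the packets which are then actually transmitted (the choice of packets within
  a queue is left to the policy); \<open>combined D n\<close> are the tags whose raw packets are combined at n.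
\<close>

record 'v decision =
  assigned :: "'v \<Rightarrow> tag set"
  service :: "nat \<Rightarrow> 'v \<Rightarrow> 'v \<Rightarrow> 'v \<Rightarrow> nat"
  moved :: "nat \<Rightarrow> 'v \<Rightarrow> 'v \<Rightarrow> 'v \<Rightarrow> tag set"
  combined :: "'v \<Rightarrow> tag set"

definition admissible ::
  "'v query_network \<Rightarrow> 'v net_state \<Rightarrow> tag set \<Rightarrow> 'v decision \<Rightarrow> bool"
where
  "admissible N S new D \<longleftrightarrow>
     (\<Union>n\<in>comp_nodes N. assigned D n) = new \<and> disjoint_family_on (assigned D) (comp_nodes N) \<and>
     (\<forall>(m, k)\<in>edges N.
        real (\<Sum>(i, n)\<in>packet_classes N. service D i n m k + service D i n k m) \<le> link_cap N m k) \<and>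
     (\<forall>(i, n)\<in>packet_classes N. \<forall>m\<in>nodes N.
        (\<forall>k\<in>nbrs (edges N) m.
           moved D i n m k \<subseteq> queued S i n m \<and> card (moved D i n m k) \<le> service D i n m k) \<and>
        disjoint_family_on (moved D i n m) (nbrs (edges N) m) \<and>
        card (\<Union>k\<in>nbrs (edges N) m. moved D i n m k) =
          min (\<Sum>k\<in>nbrs (edges N) m. service D i n m k) (card (queued S i n m))) \<and>
     (\<forall>n\<in>comp_nodes N.
        real (card (combined D n)) \<le>
          min (comp_cap N n) (min (real (card (waiting S 1 n))) (real (card (waiting S 2 n)))) \<and>
        combined D n \<subseteq> waiting S 1 n \<inter> waiting S 2 n)"

definition empty_state :: "'v net_state" where
  "empty_state = \<lparr>queued = (\<lambda>_ _ _. {}), waiting = (\<lambda>_ _. {})\<rparr>"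

text \<open>
  Packets reaching the destination of their class leave its queues: raw packets enter the waiting
  set of the computation node, processed packets leave the network. Raw packets generated at their
  own computation node start in the waiting set.
\<close>

definition next_state :: "'v query_network \<Rightarrow> 'v net_state \<Rightarrow> 'v decision \<Rightarrow> 'v net_state" where
  "next_state N S D =
     \<lparr>queued = (\<lambda>i n k.
        if k = class_dst N (i, n) then {}
        else (queued S i n k - (\<Union>l\<in>nbrs (edges N) k. moved D i n k l))
          \<union> (\<Union>m\<in>nbrs (edges N) k. moved D i n m k)
          \<union> (if k = class_src N (i, n) then (if i = 0 then combined D n else assigned D n) else {})),
      waiting = (\<lambda>i n.
        (waiting S i n - combined D n)
          \<union> (\<Union>m\<in>nbrs (edges N) n. moved D i n m n)
          \<union> (if class_src N (i, n) = n then assigned D n else {}))\<rparr>"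

primrec net_state_at ::
  "'v query_network \<Rightarrow> (nat \<Rightarrow> 'w \<Rightarrow> 'v decision) \<Rightarrow> nat \<Rightarrow> 'w \<Rightarrow> 'v net_state"
where
  "net_state_at N \<pi> 0 \<omega> = empty_state"
| "net_state_at N \<pi> (Suc t) \<omega> = next_state N (net_state_at N \<pi> t \<omega>) (\<pi> t \<omega>)"

definition queue_len ::
  "'v query_network \<Rightarrow> (nat \<Rightarrow> 'w \<Rightarrow> 'v decision) \<Rightarrow> nat \<Rightarrow> 'v \<Rightarrow> 'v \<Rightarrow> nat \<Rightarrow> 'w \<Rightarrow> nat"
where
  "queue_len N \<pi> i n k t \<omega> = card (queued (net_state_at N \<pi> t \<omega>) i n k)"

definition waiting_len ::
  "'v query_network \<Rightarrow> (nat \<Rightarrow> 'w \<Rightarrow> 'v decision) \<Rightarrow> nat \<Rightarrow> 'v \<Rightarrow> nat \<Rightarrow> 'w \<Rightarrow> nat"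
where
  "waiting_len N \<pi> i n t \<omega> = card (waiting (net_state_at N \<pi> t \<omega>) i n)"

definition iid_arrivals :: "'w measure \<Rightarrow> (nat \<Rightarrow> 'w \<Rightarrow> nat) \<Rightarrow> real \<Rightarrow> bool" where
  "iid_arrivals M A rate \<longleftrightarrow>
     prob_space.indep_vars M (\<lambda>_. count_space UNIV) A UNIV \<and>
     (\<forall>t. distr M (count_space UNIV) (A t) = distr M (count_space UNIV) (A 0)) \<and>
     (\<forall>t. integrable M (\<lambda>\<omega>. real (A t \<omega>)) \<and> prob_space.expectation M (\<lambda>\<omega>. real (A t \<omega>)) = rate)"

text \<open>
  F t is the information available when the decisions of slot t are taken. It contains the new
  arrivals of slot t and, through the past decisions, the queue contents at slot t; it may also
  contain the history and auxiliary randomisation, but it is independent of future arrivals.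
\<close>

definition causal ::
  "'v query_network \<Rightarrow> 'w measure \<Rightarrow> (nat \<Rightarrow> 'w \<Rightarrow> nat) \<Rightarrow> (nat \<Rightarrow> 'w \<Rightarrow> 'v decision) \<Rightarrow> bool"
where
  "causal N M A \<pi> \<longleftrightarrow> (\<exists>F :: nat \<Rightarrow> 'w measure.
     filtration (space M) F \<and> (\<forall>t. sets (F t) \<subseteq> sets M) \<and>
     (\<forall>t. A t \<in> measurable (F t) (count_space UNIV)) \<and>
     (\<forall>t. prob_space.indep_set M (sets (F t))
        (sets (vimage_algebra (space M) (A (Suc t)) (count_space UNIV)))) \<and>
     (\<forall>t x. \<forall>n\<in>comp_nodes N.
        Measurable.pred (F t) (\<lambda>\<omega>. x \<in> assigned (\<pi> t \<omega>) n) \<and>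
        Measurable.pred (F t) (\<lambda>\<omega>. x \<in> combined (\<pi> t \<omega>) n)) \<and>
     (\<forall>t x. \<forall>(i, n)\<in>packet_classes N. \<forall>(m, k)\<in>edges N.
        (\<lambda>\<omega>. service (\<pi> t \<omega>) i n m k) \<in> measurable (F t) (count_space UNIV) \<and>
        Measurable.pred (F t) (\<lambda>\<omega>. x \<in> moved (\<pi> t \<omega>) i n m k)))"

definition policies ::
  "'v query_network \<Rightarrow> 'w measure \<Rightarrow> (nat \<Rightarrow> 'w \<Rightarrow> nat) \<Rightarrow> (nat \<Rightarrow> 'w \<Rightarrow> 'v decision) set"
where
  "policies N M A = {\<pi>. causal N M A \<pi> \<and>
     (\<forall>t. \<forall>\<omega>\<in>space M. admissible N (net_state_at N \<pi> t \<omega>) (new_tags A t \<omega>) (\<pi> t \<omega>))}"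

text \<open>Expectations are taken in the extended nonnegative reals, so they may be infinite.\<close>

definition strongly_stable_queue :: "'w measure \<Rightarrow> (nat \<Rightarrow> 'w \<Rightarrow> nat) \<Rightarrow> bool" where
  "strongly_stable_queue M Q \<longleftrightarrow>
     limsup (\<lambda>T. (\<Sum>t = 1..T. \<integral>\<^sup>+ \<omega>. of_nat (Q t \<omega>) \<partial>M) / of_nat T) < (\<infinity> :: ennreal)"

definition stable_under ::
  "'v query_network \<Rightarrow> 'w measure \<Rightarrow> (nat \<Rightarrow> 'w \<Rightarrow> 'v decision) \<Rightarrow> bool"
where
  "stable_under N M \<pi> \<longleftrightarrow>
     (\<forall>k\<in>nodes N. \<forall>i\<in>{0, 1, 2}. \<forall>n\<in>comp_nodes N. strongly_stable_queue M (queue_len N \<pi> i n k)) \<and>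
     (\<forall>i\<in>{1, 2}. \<forall>n\<in>comp_nodes N. strongly_stable_queue M (waiting_len N \<pi> i n))"

end

theory Submission
  imports Defs
begin

text \<open>
  Every packet carries a tag, and within a class a tag never sits in two places, so queue lengths
  obey an exact conservation law along each sample path. Taking expectations and averaging over
  the first T slots, the net average outflow of a node equals its average injection minus its
  average consumption and minus E[backlog at T] / T. Strong stability keeps the expected total
  backlog bounded along some sequence of times T tending to infinity, so the last term vanishes
  there; the remaining averages are bounded, and along a common subsequence they converge to flows.
  The rate of node n is the limiting rate of combinations at n. It equals the limiting rate of
  assignments to n, because the divergence of the flow of a raw class sums to zero over all nodes.
\<close>

section \<open>Conservation of packets along a sample path\<close>

text \<open>Link flows are measured by the packets in \<open>moved\<close>, not by the allocated
  \<open>service\<close>: service may exceed the queue and only actual transmissions are conserved.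
  The link constraint passes to them because the service bounds them. Queue lengths are
  cardinalities, so a tag arriving where it already is would be lost from the count. Exact
  conservation therefore rests on the invariant \<open>tags_separate\<close>; its delicate point is
  the processed class, whose packets reuse the tags of raw packets. The flow region demands
  equalities, so no positive fraction of the packets may remain in the queues. A bounded time
  average of the expected backlog bounds its value at T only by a multiple of T; hence the choice of
  special times, which must be common to all queues. The case i = 0, \<open>k = sink N\<close> is
  excluded until the end, where the missing divergence is recovered from those of all other
  nodes.\<close>

lemma card_transfer:
  fixes P :: "'v \<Rightarrow> 'a set"
  assumes V: "finite V" "E \<subseteq> V \<times> V" "sym E" "k \<in> V"
    and P: "disjoint_family_on P V" "\<And>l. l \<in> V \<Longrightarrow> finite (P l)"
    and mv: "\<And>m l. (m, l) \<in> E \<Longrightarrow> mv m l \<subseteq> P m"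
      "\<And>m. m \<in> V \<Longrightarrow> disjoint_family_on (mv m) (nbrs E m)"
    and a: "finite a" "\<And>l. l \<in> V \<Longrightarrow> a \<inter> P l = {}"
    and r: "r \<subseteq> P k" "\<And>l. l \<in> nbrs E k \<Longrightarrow> r \<inter> mv k l = {}"
  shows "real (card ((P k - ((\<Union>l\<in>nbrs E k. mv k l) \<union> r)) \<union> (\<Union>m\<in>nbrs E k. mv m k) \<union> a)) =
    real (card (P k)) + (\<Sum>m\<in>nbrs E k. real (card (mv m k)))
      - (\<Sum>l\<in>nbrs E k. real (card (mv k l))) - real (card r) + real (card a)"
proof -
  define out where "out = (\<Union>l\<in>nbrs E k. mv k l)"
  define inn where "inn = (\<Union>m\<in>nbrs E k. mv m k)"
  have nb: "nbrs E k \<subseteq> V" and rev: "(m, k) \<in> E" if "m \<in> nbrs E k" for m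
    using V that by (auto simp: nbrs_def sym_def)
  have nbf: "finite (nbrs E k)"
    using V by (auto simp: nbrs_def intro: finite_subset[of _ V])
  have sub_out: "mv k l \<subseteq> P k" if "l \<in> nbrs E k" for l
    using mv(1) that by (auto simp: nbrs_def)
  have sub_in: "mv m k \<subseteq> P m" if "m \<in> nbrs E k" for m
    using mv(1) rev that by auto
  have inV: "m \<in> V" if "m \<in> nbrs E k" for m
    using V that by (auto simp: nbrs_def)
  have fo: "finite (mv k l)" if "l \<in> nbrs E k" for l
    using sub_out[OF that] P(2)[OF V(4)] finite_subset by blast
  have fi: "finite (mv m k)" if "m \<in> nbrs E k" for m
    using sub_in[OF that] P(2)[OF inV[OF that]] finite_subset by blast
  have co: "card out = (\<Sum>l\<in>nbrs E k. card (mv k l))"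
    unfolding out_def using nbf fo mv(2)[OF V(4)]
    by (intro card_UN_disjoint) (auto simp: disjoint_family_on_def)
  \<comment> \<open>Packets arriving over different links come from different piles, and these are
    disjoint.\<close>
  have "mv m k \<inter> mv m' k = {}" if "m \<in> nbrs E k" "m' \<in> nbrs E k" "m \<noteq> m'" for m m'
    using sub_in[OF that(1)] sub_in[OF that(2)] P(1) that inV
    unfolding disjoint_family_on_def by blast
  then have ci: "card inn = (\<Sum>m\<in>nbrs E k. card (mv m k))"
    unfolding inn_def using nbf fi by (intro card_UN_disjoint) auto
  have fP: "finite (P k)" using P V by auto
  have ro: "r \<inter> out = {}" using r(2) unfolding out_def by blast
  have os: "out \<subseteq> P k" unfolding out_def using sub_out by blast
  have fin: "finite out" "finite inn" "finite r"
    using os fP fi nbf r(1) finite_subset by (auto simp: inn_def)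
  have c1: "card (P k - (out \<union> r)) + (card out + card r) = card (P k)"
    using card_Diff_subset[of "out \<union> r" "P k"] card_Un_disjoint[of out r] fin ro os r(1) fP
      card_mono[of "P k" "out \<union> r"] by (simp add: Int_commute)
  \<comment> \<open>An arriving tag lies in the pile of its sender m. Disjointness of piles leaves
    only m = k, and then the tag was also sent out, so it is not among those remaining.\<close>
  have d1: "(P k - (out \<union> r)) \<inter> inn = {}"
  proof (rule ccontr)
    assume "\<not> ?thesis"
    then obtain x m where x: "x \<in> P k" "x \<notin> out" "m \<in> nbrs E k" "x \<in> mv m k"
      unfolding inn_def by blast
    then have "x \<in> P m" using sub_in by blast
    with x have "m = k" using P(1) V(4) inV unfolding disjoint_family_on_def by blast
    with x show False unfolding out_def by blast
  qed
  have d2: "((P k - (out \<union> r)) \<union> inn) \<inter> a = {}"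
    using a(2) V(4) sub_in inV unfolding inn_def by blast
  have "card ((P k - (out \<union> r)) \<union> inn \<union> a) = card (P k - (out \<union> r)) + card inn + card a"
    using d1 d2 fP fin a(1) by (simp add: card_Un_disjoint)
  then show ?thesis
    using c1 co ci unfolding out_def[symmetric] inn_def[symmetric] by (simp flip: of_nat_sum)
qed

text \<open>The old pile of a tag determines its new one: it stays unless it is sent, and it is sent
  over at most one link. Tags in \<open>a\<close> lie in no old pile and so cannot collide with
  these. Only an inclusion is asked of \<open>P'\<close>, which also covers the removal of consumed
  packets and the emptied sink.\<close>

lemma disjoint_transfer:
  fixes P :: "'v \<Rightarrow> 'a set"
  assumes V: "E \<subseteq> V \<times> V" "sym E"
    and P: "disjoint_family_on P V"
    and mv: "\<And>m l. (m, l) \<in> E \<Longrightarrow> mv m l \<subseteq> P m"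
      "\<And>m. m \<in> V \<Longrightarrow> disjoint_family_on (mv m) (nbrs E m)"
    and a: "\<And>k l. l \<in> V \<Longrightarrow> a k \<inter> P l = {}" "disjoint_family_on a V"
    and P': "\<And>k. k \<in> V \<Longrightarrow>
      P' k \<subseteq> (P k - (\<Union>l\<in>nbrs E k. mv k l)) \<union> (\<Union>m\<in>nbrs E k. mv m k) \<union> a k"
  shows "disjoint_family_on P' V"
  unfolding disjoint_family_on_def
proof (intro ballI impI)
  fix k k' assume k: "k \<in> V" "k' \<in> V" "k \<noteq> k'"
  have Pd: "m = m'" if "x \<in> P m" "x \<in> P m'" "m \<in> V" "m' \<in> V" for x m m'
    using that P unfolding disjoint_family_on_def by blast
  have md: "l = l'" if "x \<in> mv m l" "x \<in> mv m l'" "l \<in> nbrs E m" "l' \<in> nbrs E m" "m \<in> V" for x m l l'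
    using that mv(2)[of m] unfolding disjoint_family_on_def by blast
  have nb: "m \<in> V \<and> l \<in> nbrs E m \<and> mv m l \<subseteq> P m" if "m \<in> nbrs E l" for m l
    using that V mv(1) by (auto simp: nbrs_def sym_def)
  { fix x assume x: "x \<in> P' k" "x \<in> P' k'"
    have False
    proof (cases "x \<in> a k \<or> x \<in> a k'")
      case True
      moreover have "x \<in> (\<Union>l\<in>V. P l) \<or> x \<in> a j" if "x \<in> P' j" "j \<in> V" for j
        using P'[OF that(2)] that nb by blast
      ultimately show False
        using x k a(1) a(2) unfolding disjoint_family_on_def by blast
    next
      case False
      have *: "(x \<in> P j \<and> x \<notin> (\<Union>l\<in>nbrs E j. mv j l)) \<or> (\<exists>m. m \<in> nbrs E j \<and> x \<in> mv m j)"
        if "x \<in> P' j" "j \<in> V" "x \<notin> a j" for j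
        using P'[OF that(2)] that by blast
      \<comment> \<open>Restated through the previous location m of the tag: either m = j and the
        tag was not sent, or it travelled from m to j.\<close>
      have *: "\<exists>m\<in>V. x \<in> P m \<and> ((m = j \<and> x \<notin> (\<Union>l\<in>nbrs E j. mv j l)) \<or> (j \<in> nbrs E m \<and> x \<in> mv m j))"
        if "x \<in> P' j" "j \<in> V" "x \<notin> a j" for j
        using *[OF that] nb that(2) by blast
      obtain m where m: "m \<in> V" "x \<in> P m"
        "(m = k \<and> x \<notin> (\<Union>l\<in>nbrs E k. mv k l)) \<or> (k \<in> nbrs E m \<and> x \<in> mv m k)"
        using *[of k] x k False by blast
      obtain m' where m': "m' \<in> V" "x \<in> P m'"
        "(m' = k' \<and> x \<notin> (\<Union>l\<in>nbrs E k'. mv k' l)) \<or> (k' \<in> nbrs E m' \<and> x \<in> mv m' k')"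
        using *[of k'] x k False by blast
      have "m = m'" using Pd m m' by blast
      with m m' k show False using md by blast
    qed }
  then show "P' k \<inter> P' k' = {}" by blast
qed

text \<open>
  Treating the waiting set of n as the queue of a raw class at its destination n gives a single
  conservation law, in which \<open>injected\<close> and \<open>consumed\<close> collect assignments and combinations.
\<close>

definition pile :: "'v net_state \<Rightarrow> nat \<Rightarrow> 'v \<Rightarrow> 'v \<Rightarrow> tag set" where
  "pile S i n k = (if i \<noteq> 0 \<and> k = n then waiting S i n else queued S i n k)"

definition injected :: "'v query_network \<Rightarrow> 'v decision \<Rightarrow> nat \<Rightarrow> 'v \<Rightarrow> 'v \<Rightarrow> tag set" where
  "injected N D i n k =
     (if k = class_src N (i, n) then if i = 0 then combined D n else assigned D n else {})"

definition consumed :: "'v decision \<Rightarrow> nat \<Rightarrow> 'v \<Rightarrow> 'v \<Rightarrow> tag set" where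
  "consumed D i n k = (if i \<noteq> 0 \<and> k = n then combined D n else {})"

text \<open>
  The last clause makes a combined tag new to the processed class: it still lies in
  \<open>waiting S 1 n\<close>, hence in no processed queue.
\<close>

definition tags_separate :: "'v query_network \<Rightarrow> nat \<Rightarrow> 'v net_state \<Rightarrow> bool" where
  "tags_separate N t S \<longleftrightarrow> (\<forall>n\<in>comp_nodes N.
     (\<forall>i\<in>{0, 1, 2}.
        disjoint_family_on (pile S i n) (nodes N) \<and>
        queued S i n (class_dst N (i, n)) = {} \<and>
        (\<forall>k\<in>nodes N. finite (pile S i n k) \<and> pile S i n k \<subseteq> {..<t} \<times> UNIV)) \<and>
     (\<forall>k\<in>nodes N. \<forall>l\<in>nodes N. pile S 0 n k \<inter> pile S 1 n l = {}))"

lemma tags_separate_empty: "tags_separate N 0 empty_state"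
  by (auto simp: tags_separate_def empty_state_def pile_def disjoint_family_on_def)

section \<open>One slot: balance of a pile and preservation of \<open>tags_separate\<close>\<close>

locale slot_step =
  fixes N :: "'v query_network" and S :: "'v net_state" and D :: "'v decision"
    and t a :: nat
  assumes wf: "wf_network N"
    and adm: "admissible N S ({t} \<times> {..<a}) D"
    and sep: "tags_separate N t S"
begin

lemma network:
  "finite (nodes N)" "edges N \<subseteq> nodes N \<times> nodes N" "sym (edges N)"
  "comp_nodes N \<subseteq> nodes N"
  using wf by (auto simp: wf_network_def)

context
  fixes n assumes n: "n \<in> comp_nodes N"
begin

lemma sep_class:
  assumes "i \<in> {0, 1, 2}"
  shows "disjoint_family_on (pile S i n) (nodes N)"
    "queued S i n (class_dst N (i, n)) = {}"
    "k \<in> nodes N \<Longrightarrow> finite (pile S i n k)"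
    "k \<in> nodes N \<Longrightarrow> pile S i n k \<subseteq> {..<t} \<times> UNIV"
  using sep n assms unfolding tags_separate_def by blast+

lemma sep_processed: "k \<in> nodes N \<Longrightarrow> l \<in> nodes N \<Longrightarrow> pile S 0 n k \<inter> pile S 1 n l = {}"
  using sep n unfolding tags_separate_def by blast

lemma moved_queued:
  assumes "i \<in> {0, 1, 2}" "(m, k) \<in> edges N"
  shows "moved D i n m k \<subseteq> queued S i n m"
  proof -
  have "(i, n) \<in> packet_classes N" "m \<in> nodes N" "k \<in> nbrs (edges N) m"
    using assms n network by (auto simp: packet_classes_def nbrs_def)
  with adm show ?thesis unfolding admissible_def by fast
qed

lemma moved_pile:
  assumes "i \<in> {0, 1, 2}" "(m, k) \<in> edges N"
  shows "moved D i n m k \<subseteq> pile S i n m"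
proof -
  have "queued S i n m \<subseteq> pile S i n m"
    using sep_class(2)[OF assms(1)] by (auto simp: pile_def)
  with moved_queued[OF assms] show ?thesis by blast
qed

lemma moved_disjoint:
  assumes "i \<in> {0, 1, 2}" "m \<in> nodes N"
  shows "disjoint_family_on (moved D i n m) (nbrs (edges N) m)"
  proof -
  have "(i, n) \<in> packet_classes N" using assms n by (auto simp: packet_classes_def)
  with adm assms(2) show ?thesis unfolding admissible_def by fast
qed

lemma combined_waiting: "combined D n \<subseteq> waiting S 1 n" "combined D n \<subseteq> waiting S 2 n"
  using adm n unfolding admissible_def by blast+

lemma assigned_new: "assigned D n \<subseteq> {t} \<times> {..<a}"
  using adm n unfolding admissible_def by blast

lemma combined_pile: "combined D n \<subseteq> pile S 1 n n" "combined D n \<subseteq> pile S 2 n n"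
  using combined_waiting by (auto simp: pile_def)

lemma n_node: "n \<in> nodes N" using n network by blast

lemma finite_combined: "finite (combined D n)"
  using combined_pile(1) sep_class(3)[of 1 n] n_node finite_subset by blast

lemma finite_assigned: "finite (assigned D n)"
  using assigned_new finite_subset by blast

lemma finite_injected: "finite (injected N D i n k)"
  using finite_combined finite_assigned by (auto simp: injected_def)

text \<open>Assigned tags carry the slot number t, larger than that of every tag in a pile. A
  combined tag is still waiting in raw class 1, which the invariant keeps apart from the processed
  class.\<close>

lemma injected_fresh:
  assumes "i \<in> {0, 1, 2}" "l \<in> nodes N"
  shows "injected N D i n k \<inter> pile S i n l = {}"
proof (cases "i = 0")
  case True
  then show ?thesis
    using sep_processed[OF assms(2) n_node] combined_pile(1) by (auto simp: injected_def)
next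
  case False
  then have "injected N D i n k \<subseteq> {t} \<times> UNIV"
    using assigned_new by (auto simp: injected_def)
  then show ?thesis
    using sep_class(4)[OF assms] by auto
qed

lemma injected_new: "injected N D i n k \<subseteq> {..<Suc t} \<times> UNIV"
proof -
  have "combined D n \<subseteq> {..<t} \<times> UNIV"
    using combined_pile(1) sep_class(4)[of 1 n] n_node by blast
  moreover have "assigned D n \<subseteq> {..<Suc t} \<times> UNIV"
    using assigned_new by auto
  moreover have "({..<t} \<times> UNIV :: tag set) \<subseteq> {..<Suc t} \<times> UNIV"
    by auto
  ultimately show ?thesis by (auto simp: injected_def simp del: class_src.simps)
qed

lemma consumed_pile: "i \<in> {0, 1, 2} \<Longrightarrow> consumed D i n k \<subseteq> pile S i n k"
  using combined_pile by (auto simp: consumed_def)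

text \<open>Consumption happens only at the destination of a raw class, where the transit queue is
  empty and nothing can be sent.\<close>

lemma consumed_moved:
  assumes "i \<in> {0, 1, 2}" "l \<in> nbrs (edges N) k"
  shows "consumed D i n k \<inter> moved D i n k l = {}"
proof (cases "i \<noteq> 0 \<and> k = n")
  case True
  then have "queued S i n k = {}" using sep_class(2)[OF assms(1)] by auto
  then show ?thesis using moved_queued[OF assms(1), of k l] assms(2) by (auto simp: nbrs_def)
qed (auto simp: consumed_def)

text \<open>Merges the two update rules of \<open>next_state\<close>. At the destination of a raw
  class the pile is the waiting set, and subtracting outgoing packets is harmless because there are
  none. The sink is exceptional because processed packets leave the network on arrival.\<close>

lemma pile_next:
  assumes "i \<in> {0, 1, 2}" "k \<in> nodes N"
  shows "pile (next_state N S D) i n k = (if i = 0 \<and> k = sink N then {} else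
    (pile S i n k - ((\<Union>l\<in>nbrs (edges N) k. moved D i n k l) \<union> consumed D i n k)) \<union>
    (\<Union>m\<in>nbrs (edges N) k. moved D i n m k) \<union> injected N D i n k)"
proof (cases "i \<noteq> 0 \<and> k = n")
  case True
  then have "queued S i n k = {}" using sep_class(2)[OF assms(1)] by auto
  then have "(\<Union>l\<in>nbrs (edges N) k. moved D i n k l) = {}"
    using moved_queued[OF assms(1), of k] by (auto simp: nbrs_def)
  then show ?thesis using True
    by (auto simp: pile_def next_state_def consumed_def injected_def)
next
  case False
  then show ?thesis
    by (auto simp: pile_def next_state_def consumed_def injected_def)
qed

lemma card_pile_next:
  assumes "i \<in> {0, 1, 2}" "k \<in> nodes N" "\<not> (i = 0 \<and> k = sink N)"
  shows "real (card (pile (next_state N S D) i n k)) =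
    real (card (pile S i n k)) + (\<Sum>m\<in>nbrs (edges N) k. real (card (moved D i n m k)))
      - (\<Sum>l\<in>nbrs (edges N) k. real (card (moved D i n k l)))
      - real (card (consumed D i n k)) + real (card (injected N D i n k))"
  unfolding pile_next[OF assms(1,2)] if_not_P[OF assms(3)]
  by (rule card_transfer[where V = "nodes N"])
    (use network assms sep_class moved_pile moved_disjoint finite_injected injected_fresh
      consumed_pile consumed_moved in auto)

lemma pile_next_disjoint:
  assumes i: "i \<in> {0, 1, 2}"
  shows "disjoint_family_on (pile (next_state N S D) i n) (nodes N)"
proof (rule disjoint_transfer[where P = "pile S i n" and mv = "moved D i n"
      and a = "injected N D i n" and E = "edges N"])
  show "disjoint_family_on (injected N D i n) (nodes N)"
    by (auto simp: disjoint_family_on_def injected_def)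
  show "pile (next_state N S D) i n k \<subseteq> pile S i n k - \<Union> (moved D i n k ` nbrs (edges N) k) \<union>
      (\<Union>m\<in>nbrs (edges N) k. moved D i n m k) \<union> injected N D i n k" if "k \<in> nodes N" for k
    unfolding pile_next[OF i that] by auto
qed (use network i sep_class moved_pile moved_disjoint injected_fresh in auto)

lemma pile_next_subset:
  assumes i: "i \<in> {0, 1, 2}" and k: "k \<in> nodes N"
  shows "pile (next_state N S D) i n k \<subseteq>
    (\<Union>l\<in>nodes N. pile S i n l) \<union> injected N D i n k"
proof -
  have "moved D i n m k \<subseteq> pile S i n m" "m \<in> nodes N" if "m \<in> nbrs (edges N) k" for m
    using that network moved_pile[OF i, of m k] by (auto simp: nbrs_def sym_def)
  then show ?thesis unfolding pile_next[OF i k] using k by auto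
qed

text \<open>The raw packet starts the slot in the waiting set at n. It cannot remain there, being
  consumed; it cannot be sent, since transmissions draw on \<open>queued\<close>, which is empty at
  n; and it cannot be injected anew, since injected tags are fresh.\<close>

lemma combined_not_raw:
  assumes k: "k \<in> nodes N"
  shows "combined D n \<inter> pile (next_state N S D) 1 n k = {}"
proof (rule ccontr)
  assume "\<not> ?thesis"
  then obtain x where x: "x \<in> combined D n" "x \<in> pile (next_state N S D) 1 n k" by blast
  have xw: "x \<in> pile S 1 n n" using x combined_pile by blast
  have "x \<notin> injected N D 1 n k" using injected_fresh[of 1 n k] xw n_node by auto
  then consider (stay) "x \<in> pile S 1 n k" "x \<notin> consumed D 1 n k"
    | (move) m where "m \<in> nbrs (edges N) k" "x \<in> moved D 1 n m k"
    using x(2) pile_next[of 1 k] k by auto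
  then show False
  proof cases
    case stay
    then have "k = n" using xw sep_class(1)[of 1] k n_node unfolding disjoint_family_on_def by blast
    with stay x show False by (simp add: consumed_def)
  next
    case move
    have e: "(m, k) \<in> edges N" "m \<in> nodes N"
      using move network by (auto simp: nbrs_def sym_def)
    have xq: "x \<in> queued S 1 n m" using move moved_queued[of 1 m k] e by auto
    have "x \<in> pile S 1 n m" using move moved_pile[of 1 m k] e by auto
    then have "m = n" using xw sep_class(1)[of 1] e n_node unfolding disjoint_family_on_def by blast
    with xq show False using sep_class(2)[of 1] by auto
  qed
qed

text \<open>A new overlap could only come from a combined tag entering the processed class or an
  assigned one entering the raw class. The former has left the raw class by
  \<open>combined_not_raw\<close>, the latter carries the current slot number.\<close>

lemma processed_next_separate:
  assumes "k \<in> nodes N" "l \<in> nodes N"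
  shows "pile (next_state N S D) 0 n k \<inter> pile (next_state N S D) 1 n l = {}"
proof -
  have a: "pile (next_state N S D) 0 n k \<subseteq> (\<Union>l\<in>nodes N. pile S 0 n l) \<union> combined D n"
    using pile_next_subset[of 0 k] assms(1) by (auto simp: injected_def split: if_splits)
  have b: "pile (next_state N S D) 1 n l \<subseteq> (\<Union>l\<in>nodes N. pile S 1 n l) \<union> assigned D n"
    using pile_next_subset[of 1 l] assms(2) by (auto simp: injected_def split: if_splits)
  have c: "(\<Union>l\<in>nodes N. pile S 0 n l) \<inter> (\<Union>l\<in>nodes N. pile S 1 n l) = {}"
    using sep_processed by blast
  have d: "(\<Union>l\<in>nodes N. pile S 0 n l) \<inter> assigned D n = {}"
    using sep_class(4)[of 0] assigned_new by auto
  show ?thesis using a b c d combined_not_raw[OF assms(2)] by blast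
qed

lemma finite_pile_next:
  assumes i: "i \<in> {0, 1, 2}" and k: "k \<in> nodes N"
  shows "finite (pile (next_state N S D) i n k)"
    "pile (next_state N S D) i n k \<subseteq> {..<Suc t} \<times> UNIV"
proof -
  have "finite (\<Union>l\<in>nodes N. pile S i n l)" using network sep_class(3)[OF i] by auto
  then show "finite (pile (next_state N S D) i n k)"
    using pile_next_subset[OF assms] finite_injected finite_subset by blast
  have "(\<Union>l\<in>nodes N. pile S i n l) \<subseteq> {..<Suc t} \<times> UNIV"
    using sep_class(4)[OF i] less_SucI by blast
  then show "pile (next_state N S D) i n k \<subseteq> {..<Suc t} \<times> UNIV"
    using pile_next_subset[OF assms] injected_new by blast
qed

end

lemma tags_separate_next: "tags_separate N (Suc t) (next_state N S D)"
  unfolding tags_separate_def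
proof (intro ballI conjI)
  fix n i assume "n \<in> comp_nodes N" "i \<in> {0, 1, 2::nat}"
  then show "disjoint_family_on (pile (next_state N S D) i n) (nodes N)"
    by (rule pile_next_disjoint)
  show "queued (next_state N S D) i n (class_dst N (i, n)) = {}"
    by (simp add: next_state_def)
next
  fix n i k assume "n \<in> comp_nodes N" "i \<in> {0, 1, 2::nat}" "k \<in> nodes N"
  then show "finite (pile (next_state N S D) i n k)"
    "pile (next_state N S D) i n k \<subseteq> {..<Suc t} \<times> UNIV"
    by (rule finite_pile_next)+
next
  fix n k l assume "n \<in> comp_nodes N" "k \<in> nodes N" "l \<in> nodes N"
  then show "pile (next_state N S D) 0 n k \<inter> pile (next_state N S D) 1 n l = {}"
    by (rule processed_next_separate)
qed

end

section \<open>Averages and subsequences\<close>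

text \<open>Bolzano-Weierstrass, one sequence at a time within the subsequence found so far;
  convergence already obtained survives further thinning.\<close>

lemma common_convergent_subseq:
  fixes X :: "(nat \<Rightarrow> real) set"
  assumes "finite X" "\<And>x. x \<in> X \<Longrightarrow> Bseq x"
  shows "\<exists>s :: nat \<Rightarrow> nat. strict_mono s \<and> (\<forall>x\<in>X. convergent (x \<circ> s))"
  using assms
proof (induction X)
  case empty
  show ?case by (intro exI[of _ id]) (simp add: strict_mono_id)
next
  case (insert x X)
  then obtain s :: "nat \<Rightarrow> nat" where s: "strict_mono s" "\<forall>y\<in>X. convergent (y \<circ> s)" by blast
  have "bounded (range (x \<circ> s))"
    using insert.prems[of x] by (auto simp: Bseq_eq_bounded intro: bounded_subset)
  then obtain l r where r: "strict_mono (r :: nat \<Rightarrow> nat)" "((x \<circ> s) \<circ> r) \<longlonglongrightarrow> l"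
    using bounded_imp_convergent_subsequence by blast
  have "convergent (y \<circ> (s \<circ> r))" if "y \<in> X" for y
    using convergent_subseq_convergent[OF s(2)[rule_format, OF that] r(1)] by (simp add: comp_assoc)
  moreover have "convergent (x \<circ> (s \<circ> r))"
    using r(2) unfolding convergent_def by (auto simp: comp_assoc)
  ultimately show ?case
    using strict_mono_o[OF s(1) r(1)] by blast
qed

text \<open>If q exceeded the bound from n on, the terms after n alone would break the estimate on
  the sum. The factor 2 pays for \<open>T \<le> 2 * (T - n)\<close>, the summand 1 makes the
  contradiction strict, and the absolute value covers a negative B.\<close>

lemma bounded_average_frequently_small:
  fixes q :: "nat \<Rightarrow> real"
  assumes q: "\<And>t. 0 \<le> q t" and B: "eventually (\<lambda>T. (\<Sum>t = 1..T. q t) \<le> B * real T) sequentially"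
  shows "\<exists>t\<ge>n. q t \<le> 2 * \<bar>B\<bar> + 1"
proof (rule ccontr)
  assume "\<not> ?thesis"
  then have big: "q t > 2 * \<bar>B\<bar> + 1" if "t \<ge> n" for t using that by force
  obtain T0 where T0: "\<And>T. T \<ge> T0 \<Longrightarrow> (\<Sum>t = 1..T. q t) \<le> B * real T"
    using B by (auto simp: eventually_sequentially)
  define T where "T = max T0 (2 * n + 1)"
  have T: "T \<ge> 2 * n + 1" "T \<ge> T0" by (auto simp: T_def)
  have "real (T - n) * (2 * \<bar>B\<bar> + 1) = (\<Sum>t\<in>{n+1..T}. 2 * \<bar>B\<bar> + 1)"
    using T by simp
  also have "\<dots> \<le> (\<Sum>t\<in>{n+1..T}. q t)"
    by (intro sum_mono) (use big in \<open>simp add: less_imp_le\<close>)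
  also have "\<dots> \<le> (\<Sum>t = 1..T. q t)"
    by (intro sum_mono2) (use q in auto)
  also have "\<dots> \<le> B * real T" using T0 T by auto
  also have "\<dots> \<le> \<bar>B\<bar> * real T" by (intro mult_right_mono) auto
  finally have "real (T - n) * (2 * \<bar>B\<bar> + 1) \<le> \<bar>B\<bar> * real T" .
  moreover have "\<bar>B\<bar> * real T \<le> \<bar>B\<bar> * (2 * real (T - n))"
    using T by (intro mult_left_mono) auto
  moreover have "real (T - n) > 0" using T by auto
  ultimately show False by (simp add: algebra_simps)
qed

text \<open>A finite limsup leaves room for a finite C strictly above it, and eventually the
  averages lie below C. The expectations are given as reals q t, so that the estimate can be carried
  from \<open>ennreal\<close> to the reals.\<close>

lemma strongly_stable_queue_bound:
  assumes st: "strongly_stable_queue M Q"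
    and q: "\<And>t. (\<integral>\<^sup>+ \<omega>. of_nat (Q t \<omega>) \<partial>M) = ennreal (q t)" "\<And>t. 0 \<le> q t"
  shows "\<exists>B. eventually (\<lambda>T. (\<Sum>t = 1..T. q t) \<le> B * real T) sequentially"
proof -
  have "limsup (\<lambda>T. (\<Sum>t = 1..T. ennreal (q t)) / of_nat T) < \<infinity>"
    using st unfolding strongly_stable_queue_def q(1) .
  then obtain C where C: "limsup (\<lambda>T. (\<Sum>t = 1..T. ennreal (q t)) / of_nat T) < C" "C < \<infinity>"
    using dense by blast
  obtain B where B: "C = ennreal B" "0 \<le> B"
    using C(2) by (cases C) auto
  have "eventually (\<lambda>T. (\<Sum>t = 1..T. ennreal (q t)) / of_nat T < ennreal B) sequentially"
    using Limsup_lessD[OF C(1)] B by simp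
  then have "eventually (\<lambda>T. (\<Sum>t = 1..T. q t) \<le> B * real T) sequentially"
    using eventually_gt_at_top[of 0]
  proof eventually_elim
    case (elim T)
    have "(\<Sum>t = 1..T. ennreal (q t)) / of_nat T = ennreal ((\<Sum>t = 1..T. q t) / real T)"
      using q(2) elim(2)
      by (simp add: sum_nonneg divide_ennreal sum_ennreal ennreal_of_nat_eq_real_of_nat)
    with elim have "(\<Sum>t = 1..T. q t) / real T < B"
      by (simp add: ennreal_less_iff sum_nonneg q(2))
    with elim(2) show ?case by (simp add: field_simps)
  qed
  then show ?thesis by blast
qed

text \<open>The injection \<open>to_nat\<close> preserves cardinalities and reduces the claim to
  sets of naturals, where \<open>measurable_card\<close> applies.\<close>

lemma measurable_card_countable:
  fixes S :: "'w \<Rightarrow> 'a :: countable set"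
  assumes "\<And>x. Measurable.pred M (\<lambda>\<omega>. x \<in> S \<omega>)"
  shows "(\<lambda>\<omega>. real (card (S \<omega>))) \<in> borel_measurable M"
proof -
  have "Measurable.pred M (\<lambda>\<omega>. j \<in> to_nat ` S \<omega>)" for j
  proof -
    have "(\<lambda>\<omega>. j \<in> to_nat ` S \<omega>) = (\<lambda>\<omega>. j \<in> range (to_nat :: 'a \<Rightarrow> nat) \<and> from_nat j \<in> S \<omega>)"
      by (intro ext) (auto simp: image_iff)
    then show ?thesis using assms by simp
  qed
  then have "(\<lambda>\<omega>. card (to_nat ` S \<omega>)) \<in> measurable M (count_space UNIV)"
    by (intro measurable_card) (simp add: pred_def)
  then have "(\<lambda>\<omega>. card (S \<omega>)) \<in> measurable M (count_space UNIV)"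
    by (simp add: card_image inj_on_def)
  then show ?thesis by simp
qed

text \<open>Each ordered pair in E counts once positively at its tail and once negatively at its
  head; by symmetry of E, \<open>nbrs\<close> lists the incoming links as well as the outgoing
  ones.\<close>

lemma sum_divergence_eq_0:
  fixes g :: "'v \<Rightarrow> 'v \<Rightarrow> real"
  assumes V: "finite V" "E \<subseteq> V \<times> V" "sym E"
  shows "(\<Sum>m\<in>V. (\<Sum>k\<in>nbrs E m. g m k) - (\<Sum>k\<in>nbrs E m. g k m)) = 0"
proof -
  have *: "(\<Sum>k\<in>nbrs E m. h k) = (\<Sum>k\<in>V. if (m, k) \<in> E then h k else 0)" if "m \<in> V" for m and h :: "'v \<Rightarrow> real"
    using V that by (intro sum.mono_neutral_cong_left) (auto simp: nbrs_def)
  have "(\<Sum>m\<in>V. \<Sum>k\<in>V. if (m, k) \<in> E then g k m else 0) =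
      (\<Sum>m\<in>V. \<Sum>k\<in>V. if (m, k) \<in> E then g m k else 0)"
    using V(3) by (subst sum.swap) (auto intro!: sum.cong simp: sym_def)
  then show ?thesis using * by (simp add: sum_subtractf)
qed

text \<open>The window is 0 to T - 1, the slots whose decisions produce the state at time T, whereas
  stability averages over 1 to T. For T = 0 the value is 0.\<close>

definition avg :: "(nat \<Rightarrow> real) \<Rightarrow> nat \<Rightarrow> real" where
  "avg x T = (\<Sum>t<T. x t) / real T"

lemma avg_add: "avg (\<lambda>t. x t + y t) T = avg x T + avg y T"
  by (simp add: avg_def sum.distrib add_divide_distrib)

lemma avg_diff: "avg (\<lambda>t. x t - y t) T = avg x T - avg y T"
  by (simp add: avg_def sum_subtractf diff_divide_distrib)

lemma avg_sum: "avg (\<lambda>t. \<Sum>j\<in>J. x j t) T = (\<Sum>j\<in>J. avg (x j) T)"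
  by (simp add: avg_def sum_divide_distrib sum.swap[of _ J])

lemma avg_nonneg: "(\<And>t. 0 \<le> x t) \<Longrightarrow> 0 \<le> avg x T"
  by (simp add: avg_def sum_nonneg)

lemma avg_const: "T > 0 \<Longrightarrow> avg (\<lambda>t. c) T = c"
  by (simp add: avg_def)

lemma avg_zero: "avg (\<lambda>t. 0) T = 0"
  by (simp add: avg_def)

lemma avg_le:
  assumes "\<And>t. x t \<le> c" "0 \<le> c"
  shows "avg x T \<le> c"
proof (cases "T = 0")
  case False
  have "(\<Sum>t<T. x t) \<le> c * real T"
    using sum_mono[of "{..<T}" x "\<lambda>_. c"] assms by (simp add: mult.commute)
  with False show ?thesis by (simp add: avg_def field_simps)
qed (simp add: avg_def assms)

lemma avg_increment:
  assumes "q 0 = 0" "\<And>t. q (Suc t) = q t + x t"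
  shows "avg x T = q T / real T"
proof -
  have "(\<Sum>t<T. x t) = q T" by (induction T) (simp_all add: assms)
  then show ?thesis by (simp add: avg_def)
qed

section \<open>Expected rates under a policy\<close>

lemma admissible_facts:
  assumes "admissible N S new D"
  shows admissible_cover: "(\<Union>n\<in>comp_nodes N. assigned D n) = new"
    and admissible_disjoint: "disjoint_family_on (assigned D) (comp_nodes N)"
    and admissible_link: "(m, k) \<in> edges N \<Longrightarrow>
      real (\<Sum>(i, n)\<in>packet_classes N. service D i n m k + service D i n k m) \<le> link_cap N m k"
    and admissible_service: "(i, n) \<in> packet_classes N \<Longrightarrow> m \<in> nodes N \<Longrightarrow> k \<in> nbrs (edges N) m \<Longrightarrow>
      card (moved D i n m k) \<le> service D i n m k"
    and admissible_combined: "n \<in> comp_nodes N \<Longrightarrow> real (card (combined D n)) \<le> comp_cap N n"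
proof -
  note adm = assms[unfolded admissible_def]
  show "(\<Union>n\<in>comp_nodes N. assigned D n) = new"
    using adm by (elim conjE)
  show "disjoint_family_on (assigned D) (comp_nodes N)"
    using adm by (elim conjE)
  show "real (\<Sum>(i, n)\<in>packet_classes N. service D i n m k + service D i n k m) \<le> link_cap N m k"
    if "(m, k) \<in> edges N"
    using adm that by fast
  show "card (moved D i n m k) \<le> service D i n m k"
    if "(i, n) \<in> packet_classes N" "m \<in> nodes N" "k \<in> nbrs (edges N) m"
    using adm that by fast
  have "\<forall>n\<in>comp_nodes N. real (card (combined D n)) \<le>
          min (comp_cap N n) (min (real (card (waiting S 1 n))) (real (card (waiting S 2 n)))) \<and>
        combined D n \<subseteq> waiting S 1 n \<inter> waiting S 2 n"
    using adm by (elim conjE)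
  then show "real (card (combined D n)) \<le> comp_cap N n" if "n \<in> comp_nodes N"
    using that by simp
qed

locale policy_run = prob_space M for M :: "'w measure" +
  fixes N :: "'v query_network" and A :: "nat \<Rightarrow> 'w \<Rightarrow> nat"
    and \<pi> :: "nat \<Rightarrow> 'w \<Rightarrow> 'v decision" and rate :: real
  assumes wf: "wf_network N"
    and policy: "\<pi> \<in> policies N M A"
    and arrivals: "\<And>t. integrable M (\<lambda>\<omega>. real (A t \<omega>))"
      "\<And>t. expectation (\<lambda>\<omega>. real (A t \<omega>)) = rate"
begin

lemma network:
  "finite (nodes N)" "edges N \<subseteq> nodes N \<times> nodes N" "sym (edges N)"
  "comp_nodes N \<subseteq> nodes N" "finite (comp_nodes N)" "finite (packet_classes N)"
  "finite (edges N)"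
  using wf by (auto simp: wf_network_def packet_classes_def intro: finite_subset)

lemma class_iff: "(i, n) \<in> packet_classes N \<longleftrightarrow> i \<in> {0, 1, 2} \<and> n \<in> comp_nodes N"
  by (auto simp: packet_classes_def)

lemma edgeD:
  assumes "(m, k) \<in> edges N"
  shows "(k, m) \<in> edges N" "m \<in> nodes N" "k \<in> nodes N"
    "k \<in> nbrs (edges N) m" "m \<in> nbrs (edges N) k"
proof -
  show "(k, m) \<in> edges N" using symD[OF network(3) assms] .
  then show "m \<in> nodes N" "k \<in> nodes N" "k \<in> nbrs (edges N) m" "m \<in> nbrs (edges N) k"
    using assms network(2) by (auto simp: nbrs_def)
qed

lemma nbrsD:
  assumes "k \<in> nbrs (edges N) m"
  shows "(m, k) \<in> edges N" "(k, m) \<in> edges N"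
proof -
  show "(m, k) \<in> edges N" using assms by (simp add: nbrs_def)
  then show "(k, m) \<in> edges N" by (rule edgeD)
qed

lemma adm:
  assumes "\<omega> \<in> space M"
  shows "admissible N (net_state_at N \<pi> t \<omega>) ({t} \<times> {..<A t \<omega>}) (\<pi> t \<omega>)"
  using policy assms by (simp add: policies_def new_tags_def)

lemma slot_step:
  assumes "\<omega> \<in> space M"
  shows "slot_step N (net_state_at N \<pi> t \<omega>) (\<pi> t \<omega>) t (A t \<omega>)"
proof (induction t)
  case 0
  show ?case using wf adm[OF assms, of 0] by unfold_locales (simp_all add: tags_separate_empty)
next
  case (Suc t)
  show ?case
    using wf adm[OF assms, of "Suc t"] slot_step.tags_separate_next[OF Suc]
    by unfold_locales simp_all
qed

section \<open>Measurability, capacity bounds and integrability of the decisions\<close>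

lemma decision_measurable:
  shows "n \<in> comp_nodes N \<Longrightarrow> (\<lambda>\<omega>. real (card (assigned (\<pi> t \<omega>) n))) \<in> borel_measurable M"
    and "n \<in> comp_nodes N \<Longrightarrow> (\<lambda>\<omega>. real (card (combined (\<pi> t \<omega>) n))) \<in> borel_measurable M"
    and "(i, n) \<in> packet_classes N \<Longrightarrow> (m, k) \<in> edges N \<Longrightarrow>
      (\<lambda>\<omega>. real (card (moved (\<pi> t \<omega>) i n m k))) \<in> borel_measurable M"
proof -
  obtain F :: "nat \<Rightarrow> 'w measure" where F: "filtration (space M) F" "\<And>t. sets (F t) \<subseteq> sets M"
    and c: "\<And>t x n. n \<in> comp_nodes N \<Longrightarrow> Measurable.pred (F t) (\<lambda>\<omega>. x \<in> assigned (\<pi> t \<omega>) n)"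
      "\<And>t x n. n \<in> comp_nodes N \<Longrightarrow> Measurable.pred (F t) (\<lambda>\<omega>. x \<in> combined (\<pi> t \<omega>) n)"
    and m: "\<forall>t x. \<forall>(i, n)\<in>packet_classes N. \<forall>(m, k)\<in>edges N.
        (\<lambda>\<omega>. service (\<pi> t \<omega>) i n m k) \<in> measurable (F t) (count_space UNIV) \<and>
        Measurable.pred (F t) (\<lambda>\<omega>. x \<in> moved (\<pi> t \<omega>) i n m k)"
    using policy unfolding policies_def causal_def by blast
  \<comment> \<open>All members of a filtration share the space of M, so only the inclusion of
    sigma-algebras matters.\<close>
  have lift: "Measurable.pred M P" if "Measurable.pred (F t) P" for P
    using that F(2)[of t] filtration.space_F[OF F(1), of t] unfolding pred_def by auto
  show "(\<lambda>\<omega>. real (card (assigned (\<pi> t \<omega>) n))) \<in> borel_measurable M" if "n \<in> comp_nodes N"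
    by (intro measurable_card_countable lift c that)
  show "(\<lambda>\<omega>. real (card (combined (\<pi> t \<omega>) n))) \<in> borel_measurable M" if "n \<in> comp_nodes N"
    by (intro measurable_card_countable lift c that)
  have "Measurable.pred (F t) (\<lambda>\<omega>. x \<in> moved (\<pi> t \<omega>) i n m k)"
    if "(i, n) \<in> packet_classes N" "(m, k) \<in> edges N" for x
    using m that by fast
  note moved_pred = this
  show "(\<lambda>\<omega>. real (card (moved (\<pi> t \<omega>) i n m k))) \<in> borel_measurable M"
    if "(i, n) \<in> packet_classes N" "(m, k) \<in> edges N"
    by (intro measurable_card_countable lift moved_pred that)
qed

lemma link_capacity:
  assumes "\<omega> \<in> space M" "(m, k) \<in> edges N"
  shows "(\<Sum>(i, n)\<in>packet_classes N.
      real (card (moved (\<pi> t \<omega>) i n m k)) + real (card (moved (\<pi> t \<omega>) i n k m))) \<le> link_cap N m k"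
proof -
  note adm = adm[OF assms(1), of t]
  have "card (moved (\<pi> t \<omega>) i n m k) \<le> service (\<pi> t \<omega>) i n m k \<and>
        card (moved (\<pi> t \<omega>) i n k m) \<le> service (\<pi> t \<omega>) i n k m" if "(i, n) \<in> packet_classes N" for i n
    using admissible_service[OF adm that] edgeD[OF assms(2)] by blast
  then have "(\<Sum>(i, n)\<in>packet_classes N.
      real (card (moved (\<pi> t \<omega>) i n m k)) + real (card (moved (\<pi> t \<omega>) i n k m)))
    \<le> (\<Sum>(i, n)\<in>packet_classes N. real (service (\<pi> t \<omega>) i n m k + service (\<pi> t \<omega>) i n k m))"
    by (intro sum_mono) (fastforce simp flip: of_nat_add)
  also have "\<dots> = real (\<Sum>(i, n)\<in>packet_classes N. service (\<pi> t \<omega>) i n m k + service (\<pi> t \<omega>) i n k m)"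
    by (simp add: case_prod_unfold)
  also have "\<dots> \<le> link_cap N m k"
    by (rule admissible_link[OF adm assms(2)])
  finally show ?thesis .
qed

lemma moved_le_capacity:
  assumes "\<omega> \<in> space M" "(m, k) \<in> edges N" "(i, n) \<in> packet_classes N"
  shows "real (card (moved (\<pi> t \<omega>) i n m k)) \<le> link_cap N m k"
proof -
  have "real (card (moved (\<pi> t \<omega>) i n m k)) + real (card (moved (\<pi> t \<omega>) i n k m)) \<le>
    (\<Sum>(i, n)\<in>packet_classes N.
      real (card (moved (\<pi> t \<omega>) i n m k)) + real (card (moved (\<pi> t \<omega>) i n k m)))"
    using member_le_sum[OF assms(3), of "\<lambda>(i, n). real (card (moved (\<pi> t \<omega>) i n m k)) +
        real (card (moved (\<pi> t \<omega>) i n k m))"] network(6) by auto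
  with link_capacity[OF assms(1,2), of t] show ?thesis by linarith
qed

lemma combined_le_capacity:
  assumes "\<omega> \<in> space M" "n \<in> comp_nodes N"
  shows "real (card (combined (\<pi> t \<omega>) n)) \<le> comp_cap N n"
  by (rule admissible_combined[OF adm[OF assms(1)] assms(2)])

lemma assigned_total:
  assumes "\<omega> \<in> space M"
  shows "(\<Sum>n\<in>comp_nodes N. real (card (assigned (\<pi> t \<omega>) n))) = real (A t \<omega>)"
proof -
  note U = admissible_cover[OF adm[OF assms, of t]]
    and d = admissible_disjoint[OF adm[OF assms, of t]]
  have "finite (assigned (\<pi> t \<omega>) n)" if "n \<in> comp_nodes N" for n
  proof (rule finite_subset)
    show "assigned (\<pi> t \<omega>) n \<subseteq> {t} \<times> {..<A t \<omega>}" using that by (subst U[symmetric]) blast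
  qed simp
  then have "card (\<Union>n\<in>comp_nodes N. assigned (\<pi> t \<omega>) n) =
      (\<Sum>n\<in>comp_nodes N. card (assigned (\<pi> t \<omega>) n))"
    using d network(5) by (intro card_UN_disjoint) (simp_all add: disjoint_family_on_def)
  then have "(\<Sum>n\<in>comp_nodes N. card (assigned (\<pi> t \<omega>) n)) = A t \<omega>"
    unfolding U by (simp add: card_cartesian_product)
  then show ?thesis by (metis of_nat_sum)
qed

lemma integrable_moved:
  assumes "(i, n) \<in> packet_classes N" "(m, k) \<in> edges N"
  shows "integrable M (\<lambda>\<omega>. real (card (moved (\<pi> t \<omega>) i n m k)))"
proof (rule integrable_const_bound[where B = "link_cap N m k"])
  show "AE \<omega> in M. norm (real (card (moved (\<pi> t \<omega>) i n m k))) \<le> link_cap N m k"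
    by (rule AE_I2) (simp add: moved_le_capacity assms)
qed (rule decision_measurable(3)[OF assms])

lemma integrable_combined:
  assumes "n \<in> comp_nodes N"
  shows "integrable M (\<lambda>\<omega>. real (card (combined (\<pi> t \<omega>) n)))"
proof (rule integrable_const_bound[where B = "comp_cap N n"])
  show "AE \<omega> in M. norm (real (card (combined (\<pi> t \<omega>) n))) \<le> comp_cap N n"
    by (rule AE_I2) (simp add: combined_le_capacity assms)
qed (rule decision_measurable(2)[OF assms])

lemma assigned_le:
  assumes "n \<in> comp_nodes N" "\<omega> \<in> space M"
  shows "real (card (assigned (\<pi> t \<omega>) n)) \<le> real (A t \<omega>)"
  using assigned_total[OF assms(2), of t] network(5)
    member_le_sum[OF assms(1), of "\<lambda>n. real (card (assigned (\<pi> t \<omega>) n))"] by simp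

lemma integrable_assigned:
  assumes "n \<in> comp_nodes N"
  shows "integrable M (\<lambda>\<omega>. real (card (assigned (\<pi> t \<omega>) n)))"
proof (rule Bochner_Integration.integrable_bound[OF arrivals(1)[of t]])
  show "AE \<omega> in M. norm (real (card (assigned (\<pi> t \<omega>) n))) \<le> norm (real (A t \<omega>))"
    by (rule AE_I2) (simp only: real_norm_def abs_of_nat assigned_le assms)
qed (rule decision_measurable(1)[OF assms])

section \<open>Expected rates per slot and their bounds\<close>

definition sent :: "nat \<Rightarrow> 'v \<Rightarrow> 'v \<Rightarrow> 'v \<Rightarrow> nat \<Rightarrow> real" where
  "sent i n m k t = expectation (\<lambda>\<omega>. real (card (moved (\<pi> t \<omega>) i n m k)))"

definition assigning :: "'v \<Rightarrow> nat \<Rightarrow> real" where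
  "assigning n t = expectation (\<lambda>\<omega>. real (card (assigned (\<pi> t \<omega>) n)))"

definition combining :: "'v \<Rightarrow> nat \<Rightarrow> real" where
  "combining n t = expectation (\<lambda>\<omega>. real (card (combined (\<pi> t \<omega>) n)))"

definition backlog :: "nat \<Rightarrow> 'v \<Rightarrow> 'v \<Rightarrow> nat \<Rightarrow> real" where
  "backlog i n k t = expectation (\<lambda>\<omega>. real (card (pile (net_state_at N \<pi> t \<omega>) i n k)))"

lemma nonneg: "0 \<le> sent i n m k t" "0 \<le> assigning n t" "0 \<le> combining n t" "0 \<le> backlog i n k t"
  by (simp_all add: sent_def assigning_def combining_def backlog_def)

lemma sum_assigning: "(\<Sum>n\<in>comp_nodes N. assigning n t) = rate"
proof -
  have "(\<Sum>n\<in>comp_nodes N. assigning n t) =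
      expectation (\<lambda>\<omega>. \<Sum>n\<in>comp_nodes N. real (card (assigned (\<pi> t \<omega>) n)))"
    unfolding assigning_def
    by (intro Bochner_Integration.integral_sum[symmetric] integrable_assigned)
  also have "\<dots> = expectation (\<lambda>\<omega>. real (A t \<omega>))"
    by (intro Bochner_Integration.integral_cong assigned_total refl)
  finally show ?thesis using arrivals by simp
qed

lemma assigning_le: "n \<in> comp_nodes N \<Longrightarrow> assigning n t \<le> rate"
  using member_le_sum[of n "comp_nodes N" "\<lambda>n. assigning n t"] nonneg network sum_assigning by auto

lemma combining_le:
  assumes "n \<in> comp_nodes N"
  shows "combining n t \<le> comp_cap N n"
  unfolding combining_def
  by (rule integral_le_const[OF integrable_combined[OF assms] AE_I2[OF combined_le_capacity[OF _ assms]]])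

lemma sum_sent_le:
  assumes e: "(m, k) \<in> edges N"
  shows "(\<Sum>(i, n)\<in>packet_classes N. sent i n m k t + sent i n k m t) \<le> link_cap N m k"
proof -
  note e' = edgeD(1)[OF e]
  let ?f = "\<lambda>\<omega> (i, n). real (card (moved (\<pi> t \<omega>) i n m k)) + real (card (moved (\<pi> t \<omega>) i n k m))"
  have int: "integrable M (\<lambda>\<omega>. ?f \<omega> c)" if "c \<in> packet_classes N" for c
    using that integrable_moved e e' by (cases c) auto
  have "(\<Sum>(i, n)\<in>packet_classes N. sent i n m k t + sent i n k m t) =
      (\<Sum>c\<in>packet_classes N. expectation (\<lambda>\<omega>. ?f \<omega> c))"
    by (intro sum.cong) (auto simp: sent_def integrable_moved e e')
  also have "\<dots> = expectation (\<lambda>\<omega>. \<Sum>c\<in>packet_classes N. ?f \<omega> c)"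
    by (intro Bochner_Integration.integral_sum[symmetric] int)
  also have "\<dots> \<le> link_cap N m k"
    by (intro integral_le_const Bochner_Integration.integrable_sum int AE_I2 link_capacity e)
  finally show ?thesis .
qed

lemma sent_le:
  assumes "(i, n) \<in> packet_classes N" "(m, k) \<in> edges N"
  shows "sent i n m k t \<le> link_cap N m k"
  unfolding sent_def
  by (rule integral_le_const[OF integrable_moved[OF assms] AE_I2[OF moved_le_capacity[OF _ assms(2,1)]]])

text \<open>The transit queue at a destination is always empty. This supplies the clause of
  \<open>flow_region\<close> that forbids flow out of a destination.\<close>

lemma sent_dst:
  assumes c: "(i, n) \<in> packet_classes N" and e: "(class_dst N (i, n), k) \<in> edges N"
  shows "sent i n (class_dst N (i, n)) k t = 0"
proof -
  have "moved (\<pi> t \<omega>) i n (class_dst N (i, n)) k = {}" if "\<omega> \<in> space M" for \<omega>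
    using slot_step.moved_queued[OF slot_step[OF that, of t] _ _ e]
      slot_step.sep_class(2)[OF slot_step[OF that, of t]] c unfolding class_iff by blast
  then have "sent i n (class_dst N (i, n)) k t = expectation (\<lambda>\<omega>. 0)"
    unfolding sent_def by (intro Bochner_Integration.integral_cong) auto
  then show ?thesis by simp
qed

section \<open>Balance of the expected backlog\<close>

definition consuming :: "nat \<Rightarrow> 'v \<Rightarrow> 'v \<Rightarrow> nat \<Rightarrow> real" where
  "consuming i n k t = (if i \<noteq> 0 \<and> k = n then combining n t else 0)"

definition injecting :: "nat \<Rightarrow> 'v \<Rightarrow> 'v \<Rightarrow> nat \<Rightarrow> real" where
  "injecting i n k t = (if k = class_src N (i, n) then if i = 0 then combining n t else assigning n t else 0)"

lemma consumed_expectation: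
  assumes "n \<in> comp_nodes N"
  shows "integrable M (\<lambda>\<omega>. real (card (consumed (\<pi> t \<omega>) i n k)))"
    "expectation (\<lambda>\<omega>. real (card (consumed (\<pi> t \<omega>) i n k))) = consuming i n k t"
proof -
  show "integrable M (\<lambda>\<omega>. real (card (consumed (\<pi> t \<omega>) i n k)))"
    by (cases "i \<noteq> 0 \<and> k = n") (simp_all add: consumed_def integrable_combined[OF assms] if_not_P)
  show "expectation (\<lambda>\<omega>. real (card (consumed (\<pi> t \<omega>) i n k))) = consuming i n k t"
    by (simp add: consumed_def consuming_def combining_def)
qed

lemma injected_expectation:
  assumes "n \<in> comp_nodes N"
  shows "integrable M (\<lambda>\<omega>. real (card (injected N (\<pi> t \<omega>) i n k)))"
    "expectation (\<lambda>\<omega>. real (card (injected N (\<pi> t \<omega>) i n k))) = injecting i n k t"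
proof -
  consider "k \<noteq> class_src N (i, n)" | "k = class_src N (i, n)" "i = 0" | "k = class_src N (i, n)" "i \<noteq> 0"
    by blast
  then show "integrable M (\<lambda>\<omega>. real (card (injected N (\<pi> t \<omega>) i n k)))"
    by cases (simp_all add: injected_def integrable_combined[OF assms] integrable_assigned[OF assms]
        del: class_src.simps)
  show "expectation (\<lambda>\<omega>. real (card (injected N (\<pi> t \<omega>) i n k))) = injecting i n k t"
    by (simp add: injected_def injecting_def combining_def assigning_def del: class_src.simps)
qed

text \<open>Integrability travels with the balance: \<open>card_pile_next\<close> writes the next
  pile size as a combination of integrable terms, and linearity of the Bochner integral needs each
  term integrable. Induction from the empty state then gives integrability at all times.\<close>

lemma backlog_Suc_aux:
  assumes c: "(i, n) \<in> packet_classes N" and k: "k \<in> nodes N" "\<not> (i = 0 \<and> k = sink N)"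
    and int: "integrable M (\<lambda>\<omega>. real (card (pile (net_state_at N \<pi> t \<omega>) i n k)))"
  shows "integrable M (\<lambda>\<omega>. real (card (pile (net_state_at N \<pi> (Suc t) \<omega>) i n k))) \<and>
    backlog i n k (Suc t) = backlog i n k t +
      ((\<Sum>m\<in>nbrs (edges N) k. sent i n m k t) - (\<Sum>l\<in>nbrs (edges N) k. sent i n k l t)
        - consuming i n k t + injecting i n k t)"
proof -
  have n: "n \<in> comp_nodes N" "i \<in> {0, 1, 2}" using c by (auto simp: class_iff)
  let ?g = "\<lambda>\<omega>. real (card (pile (net_state_at N \<pi> t \<omega>) i n k))
      + (\<Sum>m\<in>nbrs (edges N) k. real (card (moved (\<pi> t \<omega>) i n m k)))
      - (\<Sum>l\<in>nbrs (edges N) k. real (card (moved (\<pi> t \<omega>) i n k l)))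
      - real (card (consumed (\<pi> t \<omega>) i n k)) + real (card (injected N (\<pi> t \<omega>) i n k))"
  have eq: "real (card (pile (net_state_at N \<pi> (Suc t) \<omega>) i n k)) = ?g \<omega>" if "\<omega> \<in> space M" for \<omega>
    using slot_step.card_pile_next[OF slot_step[OF that, of t] n k] by simp
  have i1: "integrable M (\<lambda>\<omega>. real (card (moved (\<pi> t \<omega>) i n m k)))" if "m \<in> nbrs (edges N) k" for m
    using nbrsD[OF that] c by (intro integrable_moved)
  have i2: "integrable M (\<lambda>\<omega>. real (card (moved (\<pi> t \<omega>) i n k l)))" if "l \<in> nbrs (edges N) k" for l
    using nbrsD[OF that] c by (intro integrable_moved)
  note ints = int i1 i2 consumed_expectation(1)[OF n(1)] injected_expectation(1)[OF n(1)]
  have "integrable M ?g"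
    by (intro Bochner_Integration.integrable_add Bochner_Integration.integrable_diff
        Bochner_Integration.integrable_sum ints)
  moreover have "expectation ?g = backlog i n k t +
      ((\<Sum>m\<in>nbrs (edges N) k. sent i n m k t) - (\<Sum>l\<in>nbrs (edges N) k. sent i n k l t)
        - consuming i n k t + injecting i n k t)"
    using n(1) by (simp add: ints backlog_def sent_def consumed_expectation injected_expectation
        Bochner_Integration.integral_sum)
  moreover have "integrable M (\<lambda>\<omega>. real (card (pile (net_state_at N \<pi> (Suc t) \<omega>) i n k))) \<longleftrightarrow>
      integrable M ?g"
    by (intro Bochner_Integration.integrable_cong eq refl)
  moreover have "backlog i n k (Suc t) = expectation ?g"
    unfolding backlog_def by (intro Bochner_Integration.integral_cong eq refl)
  ultimately show ?thesis by simp
qed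

lemma integrable_backlog:
  assumes "(i, n) \<in> packet_classes N" "k \<in> nodes N" "\<not> (i = 0 \<and> k = sink N)"
  shows "integrable M (\<lambda>\<omega>. real (card (pile (net_state_at N \<pi> t \<omega>) i n k)))"
  by (induction t) (use backlog_Suc_aux[OF assms] in \<open>auto simp: empty_state_def pile_def\<close>)

lemma avg_balance:
  assumes "(i, n) \<in> packet_classes N" "k \<in> nodes N" "\<not> (i = 0 \<and> k = sink N)"
  shows "(\<Sum>m\<in>nbrs (edges N) k. avg (sent i n m k) T) - (\<Sum>l\<in>nbrs (edges N) k. avg (sent i n k l) T)
      - avg (consuming i n k) T + avg (injecting i n k) T = backlog i n k T / real T"
proof -
  have 0: "backlog i n k 0 = 0" by (simp add: backlog_def empty_state_def pile_def)
  show ?thesis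
    using avg_increment[OF 0 conjunct2[OF backlog_Suc_aux[OF assms integrable_backlog[OF assms]]], of T]
    by (simp add: avg_add avg_diff avg_sum)
qed

lemma backlog_bound:
  assumes st: "stable_under N M \<pi>"
    and c: "(i, n) \<in> packet_classes N" and k: "k \<in> nodes N" "\<not> (i = 0 \<and> k = sink N)"
  shows "\<exists>B. eventually (\<lambda>T. (\<Sum>t = 1..T. backlog i n k t) \<le> B * real T) sequentially"
proof (rule strongly_stable_queue_bound)
  let ?Q = "\<lambda>t \<omega>. card (pile (net_state_at N \<pi> t \<omega>) i n k)"
  have "?Q = (if i \<noteq> 0 \<and> k = n then waiting_len N \<pi> i n else queue_len N \<pi> i n k)"
    by (auto simp: pile_def waiting_len_def queue_len_def fun_eq_iff)
  moreover have "strongly_stable_queue M (queue_len N \<pi> i n k)"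
    using st c k unfolding stable_under_def class_iff by blast
  moreover have "strongly_stable_queue M (waiting_len N \<pi> i n)" if "i \<noteq> 0"
    using st c that unfolding stable_under_def class_iff by blast
  ultimately show "strongly_stable_queue M ?Q" by auto
  show "(\<integral>\<^sup>+ \<omega>. of_nat (?Q t \<omega>) \<partial>M) = ennreal (backlog i n k t)" for t
    unfolding backlog_def ennreal_of_nat_eq_real_of_nat
    by (rule nn_integral_eq_integral[OF integrable_backlog[OF c k]]) simp
qed (rule nonneg)

section \<open>Limiting flows\<close>

text \<open>The times must serve all queues at once, so
  \<open>bounded_average_frequently_small\<close> is applied to the total backlog, which dominates
  each of its nonnegative summands. The bound \<open>Suc j\<close> forces the times to
  infinity.\<close>

lemma bounded_backlog_times:
  assumes st: "stable_under N M \<pi>"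
  shows "\<exists>u :: nat \<Rightarrow> nat. \<exists>B. \<forall>j. u j \<ge> Suc j \<and> (\<forall>(i, n)\<in>packet_classes N. \<forall>k\<in>nodes N.
      \<not> (i = 0 \<and> k = sink N) \<longrightarrow> backlog i n k (u j) \<le> B)"
proof -
  define J where "J = {((i, n), k) | i n k.
    (i, n) \<in> packet_classes N \<and> k \<in> nodes N \<and> \<not> (i = 0 \<and> k = sink N)}"
  define q where "q = (\<lambda>((i, n), k). backlog i n k)"
  have "J \<subseteq> packet_classes N \<times> nodes N" by (auto simp: J_def)
  then have J: "finite J" using network finite_subset by blast
  have q0: "0 \<le> q c t" for c t by (auto simp: q_def nonneg split: prod.split)
  have "\<forall>c\<in>J. \<exists>B. eventually (\<lambda>T. (\<Sum>t = 1..T. q c t) \<le> B * real T) sequentially"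
    using backlog_bound[OF st] by (auto simp: J_def q_def)
  then obtain B where "\<forall>c\<in>J. eventually (\<lambda>T. (\<Sum>t = 1..T. q c t) \<le> B c * real T) sequentially"
    by metis
  then have "eventually (\<lambda>T. \<forall>c\<in>J. (\<Sum>t = 1..T. q c t) \<le> B c * real T) sequentially"
    using J by (simp add: eventually_ball_finite)
  then have ev: "eventually (\<lambda>T. (\<Sum>t = 1..T. \<Sum>c\<in>J. q c t) \<le> (\<Sum>c\<in>J. B c) * real T) sequentially"
  proof eventually_elim
    case (elim T)
    have "(\<Sum>t = 1..T. \<Sum>c\<in>J. q c t) = (\<Sum>c\<in>J. \<Sum>t = 1..T. q c t)" by (rule sum.swap)
    also have "\<dots> \<le> (\<Sum>c\<in>J. B c * real T)" by (intro sum_mono) (use elim in auto)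
    finally show ?case by (simp add: sum_distrib_right)
  qed
  have "\<forall>j. \<exists>t\<ge>Suc j. (\<Sum>c\<in>J. q c t) \<le> 2 * \<bar>\<Sum>c\<in>J. B c\<bar> + 1"
    by (intro allI bounded_average_frequently_small[OF _ ev] sum_nonneg q0)
  then obtain u :: "nat \<Rightarrow> nat" where u: "\<And>j. u j \<ge> Suc j"
    "\<And>j. (\<Sum>c\<in>J. q c (u j)) \<le> 2 * \<bar>\<Sum>c\<in>J. B c\<bar> + 1"
    by metis
  have "q c (u j) \<le> 2 * \<bar>\<Sum>c\<in>J. B c\<bar> + 1" if "c \<in> J" for c j
    using member_le_sum[OF that, of "\<lambda>c. q c (u j)"] q0 J u(2)[of j] by force
  then have "backlog i n k (u j) \<le> 2 * \<bar>\<Sum>c\<in>J. B c\<bar> + 1"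
    if "(i, n) \<in> packet_classes N" "k \<in> nodes N" "\<not> (i = 0 \<and> k = sink N)" for i n k j
    using that unfolding J_def q_def by force
  with u(1) show ?thesis by blast
qed

lemma convergent_averages:
  assumes st: "stable_under N M \<pi>"
  obtains w F a c where
    "filterlim w at_top sequentially"
    "\<And>i n m k. (i, n) \<in> packet_classes N \<Longrightarrow> (m, k) \<in> edges N \<Longrightarrow>
      (\<lambda>j. avg (sent i n m k) (w j)) \<longlonglongrightarrow> F i n m k"
    "\<And>n. n \<in> comp_nodes N \<Longrightarrow> (\<lambda>j. avg (assigning n) (w j)) \<longlonglongrightarrow> a n"
    "\<And>n. n \<in> comp_nodes N \<Longrightarrow> (\<lambda>j. avg (combining n) (w j)) \<longlonglongrightarrow> c n"
    "\<And>i n k. (i, n) \<in> packet_classes N \<Longrightarrow> k \<in> nodes N \<Longrightarrow> \<not> (i = 0 \<and> k = sink N) \<Longrightarrow>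
      (\<lambda>j. backlog i n k (w j) / real (w j)) \<longlonglongrightarrow> 0"
proof -
  obtain u :: "nat \<Rightarrow> nat" and B where uB: "\<forall>j. u j \<ge> Suc j \<and> (\<forall>(i, n)\<in>packet_classes N. \<forall>k\<in>nodes N.
      \<not> (i = 0 \<and> k = sink N) \<longrightarrow> backlog i n k (u j) \<le> B)"
    using bounded_backlog_times[OF st] by (elim exE)
  have u: "u j \<ge> Suc j" for j using uB by blast
  have B: "backlog i n k (u j) \<le> B"
    if "(i, n) \<in> packet_classes N" "k \<in> nodes N" "\<not> (i = 0 \<and> k = sink N)" for i n k j
    using uB[rule_format, of j] that by fast
  \<comment> \<open>All averages whose limits are needed form one finite set, so that a single
    subsequence serves them. They are bounded by the link capacities, by \<open>rate\<close> and by
    the computation capacities respectively.\<close>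
  define X where "X = (\<lambda>((i, n), (m, k)). avg (sent i n m k)) ` (packet_classes N \<times> edges N) \<union>
      (\<lambda>n. avg (assigning n)) ` comp_nodes N \<union> (\<lambda>n. avg (combining n)) ` comp_nodes N"
  have bd: "Bseq (avg x \<circ> u)" if "\<And>t. 0 \<le> x t" "\<And>t. x t \<le> C" for x C
  proof (rule BseqI')
    have "0 \<le> C" using that order_trans by blast
    then show "norm ((avg x \<circ> u) j) \<le> C" for j
      using that avg_nonneg[of x "u j"] avg_le[of x C "u j"] by simp
  qed
  have "finite ((\<lambda>x. x \<circ> u) ` X)" unfolding X_def using network by blast
  moreover have "Bseq x" if "x \<in> (\<lambda>x. x \<circ> u) ` X" for x
    using that bd[OF nonneg(1) sent_le] bd[OF nonneg(2) assigning_le] bd[OF nonneg(3) combining_le]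
    unfolding X_def by fastforce
  ultimately obtain s :: "nat \<Rightarrow> nat" where s: "strict_mono s" "\<forall>x\<in>(\<lambda>x. x \<circ> u) ` X. convergent (x \<circ> s)"
    using common_convergent_subseq by blast
  \<comment> \<open>The times u need not be monotone. Divergence of w comes from
    \<open>u j \<ge> Suc j\<close> together with \<open>s j \<ge> j\<close>.\<close>
  define w where "w = u \<circ> s"
  have w_ge: "j \<le> w j" for j
    using u[of "s j"] seq_suble[OF s(1), of j] by (simp add: w_def)
  have wlim: "filterlim w at_top sequentially"
    by (rule filterlim_at_top_mono[OF filterlim_ident]) (simp add: w_ge)
  have conv: "(\<lambda>j. x (w j)) \<longlonglongrightarrow> lim (\<lambda>j. x (w j))" if "x \<in> X" for x
  proof -
    have "convergent (x \<circ> u \<circ> s)" using s(2) that by blast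
    moreover have "x \<circ> u \<circ> s = (\<lambda>j. x (w j))" by (simp add: w_def fun_eq_iff)
    ultimately show ?thesis by (simp add: convergent_LIMSEQ_iff)
  qed
  have B0: "(\<lambda>j. B / real (w j)) \<longlonglongrightarrow> 0"
    by (intro real_tendsto_divide_at_top[OF tendsto_const]
        filterlim_compose[OF filterlim_real_sequentially wlim])
  show thesis
  proof (rule that[OF wlim])
    show "(\<lambda>j. avg (sent i n m k) (w j)) \<longlonglongrightarrow> lim (\<lambda>j. avg (sent i n m k) (w j))"
      if "(i, n) \<in> packet_classes N" "(m, k) \<in> edges N" for i n m k
      by (rule conv) (use that in \<open>force simp: X_def\<close>)
    show "(\<lambda>j. avg (assigning n) (w j)) \<longlonglongrightarrow> lim (\<lambda>j. avg (assigning n) (w j))"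
      if "n \<in> comp_nodes N" for n
      by (rule conv) (use that in \<open>simp add: X_def\<close>)
    show "(\<lambda>j. avg (combining n) (w j)) \<longlonglongrightarrow> lim (\<lambda>j. avg (combining n) (w j))"
      if "n \<in> comp_nodes N" for n
      by (rule conv) (use that in \<open>simp add: X_def\<close>)
    show "(\<lambda>j. backlog i n k (w j) / real (w j)) \<longlonglongrightarrow> 0"
      if "(i, n) \<in> packet_classes N" "k \<in> nodes N" "\<not> (i = 0 \<and> k = sink N)" for i n k
    proof (rule tendsto_sandwich[OF _ _ tendsto_const B0])
      show "eventually (\<lambda>j. 0 \<le> backlog i n k (w j) / real (w j)) sequentially"
        by (simp add: nonneg)
      show "eventually (\<lambda>j. backlog i n k (w j) / real (w j) \<le> B / real (w j)) sequentially"
        using B[OF that] by (simp add: w_def divide_right_mono)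
    qed
  qed
qed

text \<open>The rate a of assignments and the rate c of combinations stay separate here: the total
  is known for a, the capacity bound for c, and a raw class enters at rate a but is consumed at rate
  c.\<close>

lemma limit_rates:
  assumes st: "stable_under N M \<pi>"
  obtains F a c where
    "\<And>i n m k. (i, n) \<in> packet_classes N \<Longrightarrow> (m, k) \<in> edges N \<Longrightarrow> 0 \<le> F i n m k"
    "\<And>i n k. (i, n) \<in> packet_classes N \<Longrightarrow> (class_dst N (i, n), k) \<in> edges N \<Longrightarrow>
      F i n (class_dst N (i, n)) k = 0"
    "\<And>m k. (m, k) \<in> edges N \<Longrightarrow>
      (\<Sum>(i, n)\<in>packet_classes N. F i n m k + F i n k m) \<le> link_cap N m k"
    "\<And>n. n \<in> comp_nodes N \<Longrightarrow> 0 \<le> c n \<and> c n \<le> comp_cap N n"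
    "(\<Sum>n\<in>comp_nodes N. a n) = rate"
    "\<And>i n k. (i, n) \<in> packet_classes N \<Longrightarrow> k \<in> nodes N \<Longrightarrow> \<not> (i = 0 \<and> k = sink N) \<Longrightarrow>
      (\<Sum>l\<in>nbrs (edges N) k. F i n k l) - (\<Sum>m\<in>nbrs (edges N) k. F i n m k) =
        (if k = class_src N (i, n) then if i = 0 then c n else a n else 0)
          - (if i \<noteq> 0 \<and> k = n then c n else 0)"
proof -
  obtain w :: "nat \<Rightarrow> nat" and F a c where
    w: "filterlim w at_top sequentially"
    and F: "\<And>i n m k. (i, n) \<in> packet_classes N \<Longrightarrow> (m, k) \<in> edges N \<Longrightarrow>
      (\<lambda>j. avg (sent i n m k) (w j)) \<longlonglongrightarrow> F i n m k"
    and a: "\<And>n. n \<in> comp_nodes N \<Longrightarrow> (\<lambda>j. avg (assigning n) (w j)) \<longlonglongrightarrow> a n"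
    and c: "\<And>n. n \<in> comp_nodes N \<Longrightarrow> (\<lambda>j. avg (combining n) (w j)) \<longlonglongrightarrow> c n"
    and b: "\<And>i n k. (i, n) \<in> packet_classes N \<Longrightarrow> k \<in> nodes N \<Longrightarrow> \<not> (i = 0 \<and> k = sink N) \<Longrightarrow>
      (\<lambda>j. backlog i n k (w j) / real (w j)) \<longlonglongrightarrow> 0"
    using convergent_averages[OF st] by blast
  show thesis
  proof (rule that[of F c a])
    show "0 \<le> F i n m k" if "(i, n) \<in> packet_classes N" "(m, k) \<in> edges N" for i n m k
      by (rule LIMSEQ_le_const[OF F[OF that]]) (simp add: avg_nonneg nonneg)
    show "F i n (class_dst N (i, n)) k = 0"
      if "(i, n) \<in> packet_classes N" "(class_dst N (i, n), k) \<in> edges N" for i n k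
      using F[OF that] by (simp add: sent_dst[OF that] avg_def LIMSEQ_const_iff del: class_dst.simps)
    show "(\<Sum>(i, n)\<in>packet_classes N. F i n m k + F i n k m) \<le> link_cap N m k"
      if e: "(m, k) \<in> edges N" for m k
    proof (rule LIMSEQ_le_const2)
      show "(\<lambda>j. \<Sum>x\<in>packet_classes N. (case x of (i, n) \<Rightarrow>
          avg (sent i n m k) (w j) + avg (sent i n k m) (w j))) \<longlonglongrightarrow>
        (\<Sum>(i, n)\<in>packet_classes N. F i n m k + F i n k m)"
        by (intro tendsto_sum) (auto intro!: tendsto_add F e edgeD(1))
      have "(\<Sum>(i, n)\<in>packet_classes N. avg (sent i n m k) T + avg (sent i n k m) T) =
          avg (\<lambda>t. \<Sum>(i, n)\<in>packet_classes N. sent i n m k t + sent i n k m t) T" for T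
        by (simp add: avg_sum avg_add case_prod_unfold)
      moreover have "0 \<le> link_cap N m k" using wf e by (auto simp: wf_network_def)
      ultimately have "(\<Sum>(i, n)\<in>packet_classes N. avg (sent i n m k) T + avg (sent i n k m) T)
          \<le> link_cap N m k" for T
        using avg_le[OF sum_sent_le[OF e]] by simp
      then show "\<exists>M. \<forall>j\<ge>M. (\<Sum>x\<in>packet_classes N. (case x of (i, n) \<Rightarrow>
          avg (sent i n m k) (w j) + avg (sent i n k m) (w j))) \<le> link_cap N m k"
        by blast
    qed
    show "0 \<le> c n \<and> c n \<le> comp_cap N n" if n: "n \<in> comp_nodes N" for n
    proof
      show "0 \<le> c n"
        by (rule LIMSEQ_le_const[OF c[OF n]]) (simp add: avg_nonneg nonneg)
      have "0 \<le> comp_cap N n" using combining_le[OF n, of 0] nonneg(3)[of n 0] by linarith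
      then show "c n \<le> comp_cap N n"
        by (intro LIMSEQ_le_const2[OF c[OF n]]) (use avg_le[OF combining_le[OF n]] in auto)
    qed
    show "(\<Sum>n\<in>comp_nodes N. a n) = rate"
    proof (rule LIMSEQ_unique)
      show "(\<lambda>j. \<Sum>n\<in>comp_nodes N. avg (assigning n) (w j)) \<longlonglongrightarrow> (\<Sum>n\<in>comp_nodes N. a n)"
        by (intro tendsto_sum a)
      \<comment> \<open>A constant has itself as average only over a nonempty window.\<close>
      have "eventually (\<lambda>j. w j > 0) sequentially"
        using w[unfolded filterlim_at_top, rule_format, of 1] by eventually_elim simp
      then have "eventually (\<lambda>j. rate = (\<Sum>n\<in>comp_nodes N. avg (assigning n) (w j))) sequentially"
        by eventually_elim (simp add: sum_assigning avg_const flip: avg_sum)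
      then show "(\<lambda>j. \<Sum>n\<in>comp_nodes N. avg (assigning n) (w j)) \<longlonglongrightarrow> rate"
        by (rule Lim_transform_eventually[OF tendsto_const])
    qed
    show "(\<Sum>l\<in>nbrs (edges N) k. F i n k l) - (\<Sum>m\<in>nbrs (edges N) k. F i n m k) =
        (if k = class_src N (i, n) then if i = 0 then c n else a n else 0)
          - (if i \<noteq> 0 \<and> k = n then c n else 0)"
      if i: "(i, n) \<in> packet_classes N" and k: "k \<in> nodes N" "\<not> (i = 0 \<and> k = sink N)" for i n k
    proof -
      have n: "n \<in> comp_nodes N" using i by (simp add: class_iff)
      have cons: "(\<lambda>j. avg (consuming i n k) (w j)) \<longlonglongrightarrow> (if i \<noteq> 0 \<and> k = n then c n else 0)"
        unfolding consuming_def[abs_def] by (cases "i \<noteq> 0 \<and> k = n") (auto simp: avg_zero c[OF n])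
      have inj: "(\<lambda>j. avg (injecting i n k) (w j)) \<longlonglongrightarrow>
          (if k = class_src N (i, n) then if i = 0 then c n else a n else 0)"
        unfolding injecting_def[abs_def]
        by (cases "k = class_src N (i, n)"; cases "i = 0")
          (simp_all add: avg_zero c[OF n] a[OF n] del: class_src.simps)
      have "(\<lambda>j. (\<Sum>m\<in>nbrs (edges N) k. avg (sent i n m k) (w j))
            - (\<Sum>l\<in>nbrs (edges N) k. avg (sent i n k l) (w j))
            - avg (consuming i n k) (w j) + avg (injecting i n k) (w j)) \<longlonglongrightarrow>
          (\<Sum>m\<in>nbrs (edges N) k. F i n m k) - (\<Sum>l\<in>nbrs (edges N) k. F i n k l)
            - (if i \<noteq> 0 \<and> k = n then c n else 0)
            + (if k = class_src N (i, n) then if i = 0 then c n else a n else 0)"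
        by (intro tendsto_add tendsto_diff tendsto_sum cons inj F i nbrsD)
      \<comment> \<open>By \<open>avg_balance\<close> the converging expression is the backlog
        divided by time, whose limit is 0.\<close>
      from LIMSEQ_unique[OF this[unfolded avg_balance[OF i k]] b[OF i k]]
      show ?thesis by linarith
    qed
  qed
qed

section \<open>From limit rates to a point of the flow region\<close>

lemma stable_rates:
  assumes st: "stable_under N M \<pi>"
  shows "\<exists>r :: 'v \<Rightarrow> real.
    (\<forall>m\<in>comp_nodes N. 0 \<le> r m) \<and>
    (\<lambda>(i, m). r m) \<in> flow_region (nodes N) (edges N) (link_cap N)
       (packet_classes N) (class_src N) (class_dst N) \<and>
    (\<forall>m\<in>comp_nodes N. r m \<le> comp_cap N m) \<and>
    (\<Sum>m\<in>comp_nodes N. r m) = rate"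
proof -
  obtain F a c where
    F0: "\<And>i n m k. (i, n) \<in> packet_classes N \<Longrightarrow> (m, k) \<in> edges N \<Longrightarrow> 0 \<le> F i n m k"
    and Fd: "\<And>i n k. (i, n) \<in> packet_classes N \<Longrightarrow> (class_dst N (i, n), k) \<in> edges N \<Longrightarrow>
      F i n (class_dst N (i, n)) k = 0"
    and Fc: "\<And>m k. (m, k) \<in> edges N \<Longrightarrow>
      (\<Sum>(i, n)\<in>packet_classes N. F i n m k + F i n k m) \<le> link_cap N m k"
    and c: "\<And>n. n \<in> comp_nodes N \<Longrightarrow> 0 \<le> c n \<and> c n \<le> comp_cap N n"
    and a: "(\<Sum>n\<in>comp_nodes N. a n) = rate"
    and bal: "\<And>i n k. (i, n) \<in> packet_classes N \<Longrightarrow> k \<in> nodes N \<Longrightarrow> \<not> (i = 0 \<and> k = sink N) \<Longrightarrow>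
      (\<Sum>l\<in>nbrs (edges N) k. F i n k l) - (\<Sum>m\<in>nbrs (edges N) k. F i n m k) =
        (if k = class_src N (i, n) then if i = 0 then c n else a n else 0)
          - (if i \<noteq> 0 \<and> k = n then c n else 0)"
    using limit_rates[OF st] by blast
  have src: "class_src N (i, n) \<in> nodes N" if "(i, n) \<in> packet_classes N" for i n
    using wf that by (auto simp: wf_network_def packet_classes_def)
  have sinkV: "sink N \<in> nodes N" using wf by (auto simp: wf_network_def)
  define D where "D = (\<lambda>i n k.
    (\<Sum>l\<in>nbrs (edges N) k. F i n k l) - (\<Sum>m\<in>nbrs (edges N) k. F i n m k))"
  have D0: "(\<Sum>k\<in>nodes N. D i n k) = 0" for i n
    unfolding D_def by (rule sum_divergence_eq_0) (use network in auto)
  have ac: "a n = c n" if n: "n \<in> comp_nodes N" for n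
  proof -
    \<comment> \<open>Either raw class serves. Its divergence gains a n at the source and loses c n
      at n, and the total is a n - c n even if the source is n itself.\<close>
    obtain i where i: "(i, n) \<in> packet_classes N" "i \<noteq> 0"
      using n by (auto simp: class_iff)
    have "D i n k = (if k = class_src N (i, n) then a n else 0) - (if k = n then c n else 0)"
      if "k \<in> nodes N" for k
      using bal[OF i(1) that] i(2) unfolding D_def by simp
    then have "(\<Sum>k\<in>nodes N. (if k = class_src N (i, n) then a n else 0) - (if k = n then c n else 0)) = 0"
      using D0[of i n] by (simp del: class_src.simps)
    moreover have "n \<in> nodes N" using n network by auto
    ultimately show ?thesis
      using network(1) src[OF i(1)] by (simp add: sum_subtractf del: class_src.simps)
  qed
  have div: "D i n k = (if k = class_src N (i, n) then c n else if k = class_dst N (i, n) then - c n else 0)"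
    if i: "(i, n) \<in> packet_classes N" and ne: "class_src N (i, n) \<noteq> class_dst N (i, n)"
      and k: "k \<in> nodes N" for i n k
  proof -
    have n: "n \<in> comp_nodes N" using i by (simp add: class_iff)
    show ?thesis
    proof (cases "i = 0")
      case False
      then show ?thesis
        using bal[OF i k] ac[OF n] ne unfolding D_def by (auto simp del: class_src.simps)
    next
      case True
      then have nn: "n \<noteq> sink N" using ne by simp
      have D: "D 0 n k = (if k = n then c n else 0)" if "k \<in> nodes N" "k \<noteq> sink N" for k
        using bal[of 0 n k] i True that unfolding D_def by simp
      \<comment> \<open>The sink has no balance of its own. Since n differs from the sink, the
        remaining nodes contribute exactly c n, and the zero total fixes the divergence at the
        sink.\<close>
      have "(\<Sum>k\<in>nodes N. D 0 n k) = D 0 n (sink N) + (\<Sum>k\<in>nodes N - {sink N}. D 0 n k)"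
        using network(1) sinkV by (rule sum.remove)
      also have "(\<Sum>k\<in>nodes N - {sink N}. D 0 n k) = (\<Sum>k\<in>nodes N - {sink N}. if k = n then c n else 0)"
        by (intro sum.cong) (auto simp: D)
      also have "\<dots> = c n"
        using network n nn by (auto simp: sum.delta)
      finally have "D 0 n (sink N) = - c n" using D0[of 0 n] by simp
      then show ?thesis using D[OF k] True nn by auto
    qed
  qed
  \<comment> \<open>A commodity with equal end points must carry no flow, so its limit flow is
    discarded; as the limits are nonnegative, this cannot raise a link load.\<close>
  define f where "f = (\<lambda>(i, n) m k. if class_src N (i, n) = class_dst N (i, n) then 0 else F i n m k)"
  have cap: "(\<Sum>x\<in>packet_classes N. f x m k + f x k m) \<le> link_cap N m k" if e: "(m, k) \<in> edges N" for m k
  proof -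
    have "(\<Sum>x\<in>packet_classes N. f x m k + f x k m) \<le>
        (\<Sum>(i, n)\<in>packet_classes N. F i n m k + F i n k m)"
      using F0 e edgeD(1)[OF e] by (intro sum_mono) (auto simp: f_def simp del: class_src.simps class_dst.simps)
    with Fc[OF e] show ?thesis by linarith
  qed
  have "(\<lambda>(i, m). c m) \<in> flow_region (nodes N) (edges N) (link_cap N)
       (packet_classes N) (class_src N) (class_dst N)"
    unfolding flow_region_def
  proof (intro CollectI exI[of _ f] conjI)
    show "\<forall>x\<in>packet_classes N. \<forall>(m, k)\<in>edges N. 0 \<le> f x m k"
      using F0 by (auto simp: f_def simp del: class_src.simps class_dst.simps)
    show "\<forall>x\<in>packet_classes N. class_src N x = class_dst N x \<longrightarrow> (\<forall>(m, k)\<in>edges N. f x m k = 0)"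
      by (auto simp: f_def simp del: class_src.simps class_dst.simps)
    show "\<forall>x\<in>packet_classes N. class_src N x \<noteq> class_dst N x \<longrightarrow> (\<forall>m\<in>nodes N.
        (\<Sum>k\<in>nbrs (edges N) m. f x m k) - (\<Sum>k\<in>nbrs (edges N) m. f x k m) =
        (if m = class_src N x then case x of (i, m) \<Rightarrow> c m
         else if m = class_dst N x then - (case x of (i, m) \<Rightarrow> c m) else 0))"
      using div[unfolded D_def]
      by (clarsimp simp: f_def simp del: class_src.simps class_dst.simps split del: if_split)
    show "\<forall>x\<in>packet_classes N. \<forall>(m, k)\<in>edges N. m = class_dst N x \<longrightarrow> f x m k = 0"
      using Fd by (auto simp: f_def simp del: class_src.simps class_dst.simps)
    show "\<forall>(m, k)\<in>edges N. (\<Sum>x\<in>packet_classes N. f x m k + f x k m) \<le> link_cap N m k"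
      using cap by auto
  qed
  then show ?thesis
    using c a ac by (intro exI[of _ c]) auto
qed

end

theorem theorem4:
  fixes N :: "'v query_network" and M :: "'w measure"
    and A :: "nat \<Rightarrow> 'w \<Rightarrow> nat" and rate :: real
  assumes "wf_network N"
    and "prob_space M"
    and "iid_arrivals M A rate"
    and "\<exists>\<pi>\<in>policies N M A. stable_under N M \<pi>"
  shows "\<exists>r :: 'v \<Rightarrow> real.
    (\<forall>m\<in>comp_nodes N. 0 \<le> r m) \<and>
    (\<lambda>(i, m). r m) \<in> flow_region (nodes N) (edges N) (link_cap N)
       (packet_classes N) (class_src N) (class_dst N) \<and>
    (\<forall>m\<in>comp_nodes N. r m \<le> comp_cap N m) \<and>
    (\<Sum>m\<in>comp_nodes N. r m) = rate"
proof -
  obtain \<pi> where "\<pi> \<in> policies N M A" "stable_under N M \<pi>" using assms(4) by blast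
  then interpret policy_run M N A \<pi> rate
    using assms(1-3) by (intro policy_run.intro policy_run_axioms.intro) (auto simp: iid_arrivals_def)
  show ?thesis by (rule stable_rates) fact
qed

end
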